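(* There exists a constant $C$ independent of $h$ and $z$ such that for all $0<h<1$ and all $z\in\Omega_h$, $$\|\nabla G_h^z\|_{L^p(\Omega_h)}\le C h^{\frac{3}{p}-2}\quad\text{for } 2\le p\le\infty,$$ where $\frac{3}{p}=0$ when $p=\infty$.
   Context: Let $\Omega\subset\mathbb{R}^3$ be a convex bounded domain with sufficiently smooth boundary. Let $\{\mathcal{T}_h\}_{0<h<1}$ be a quasi-uniform, shape-regular family of triangulations (by tetrahedra) of size $h$ of polyhedral computational domains $\Omega_h\subset\Omega$. Let $V_h(\Omega_h)$ be the space of continuous functions on $\Omega_h$ that are affine on each tetrahedron of $\mathcal{T}_h$, and let $V_h^0(\Omega_h)\subset V_h(\Omega_h)$ be the subspace of functions vanishing on $\partial\Omega_h$ (extended by zero to $\Omega$ where needed). Write $(u,v)_\Omega=\int_\Omega u\cdot v\,dx$. The discrete Green's function with singularity at $z\in\Omega_h$ is the unique $G_h^z\in V_h^0(\Omega_h)$ satisfying $(\nabla G_h^z,\nabla v_h)_\Omega=v_h(z)$ for all $v_h\in V_h^0(\Omega_h)$. *)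

theory Defs
  imports "HOL-Analysis.Analysis" "HOL-Probability.Essential_Supremum"
begin

type_synonym R3 = "real^3"

section \<open>Domains with smooth boundary\<close>

primrec Ck_on :: "nat \<Rightarrow> R3 set \<Rightarrow> (R3 \<Rightarrow> real) \<Rightarrow> bool" where
  "Ck_on 0 U f \<longleftrightarrow> continuous_on U f"
| "Ck_on (Suc k) U f \<longleftrightarrow>
     (\<exists>D. (\<forall>x\<in>U. GDERIV f x :> D x) \<and> (\<forall>i. Ck_on k U (\<lambda>x. D x $ i)))"

text \<open>Near each boundary point, \<open>\<Omega>\<close> is the negativity set of a \<open>C\<^sup>k\<close> function with nonvanishing
  gradient. This is meant for \<open>k \<ge> 1\<close>.\<close>

definition Ck_boundary :: "nat \<Rightarrow> R3 set \<Rightarrow> bool" where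
  "Ck_boundary k \<Omega> \<longleftrightarrow>
     (\<forall>x\<in>frontier \<Omega>. \<exists>U \<phi>. open U \<and> x \<in> U \<and> Ck_on k U \<phi> \<and>
        (\<forall>y\<in>U. \<not> (GDERIV \<phi> y :> 0)) \<and>
        \<Omega> \<inter> U = {y \<in> U. \<phi> y < 0} \<and> frontier \<Omega> \<inter> U = {y \<in> U. \<phi> y = 0})"


section \<open>Triangulations\<close>

definition tet_mesh :: "R3 set set \<Rightarrow> bool" where
  "tet_mesh \<T> \<longleftrightarrow> triangulation \<T> \<and> \<T> \<noteq> {} \<and> (\<forall>\<tau>\<in>\<T>. 3 simplex \<tau>)"

text \<open>Mesh cells are closed, while the computational domain they triangulate is open.\<close>

definition mesh_domain :: "R3 set set \<Rightarrow> R3 set" where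
  "mesh_domain \<T> = interior (\<Union>\<T>)"

text \<open>``Of size \<open>h\<close>'' is read as: all cell diameters are at most \<open>h\<close>. Requiring the largest diameter
  to equal \<open>h\<close> for every \<open>h < 1\<close> would exclude all \<open>\<Omega>\<close> of diameter less than 1;
  \<open>quasi_uniform\<close> supplies the matching lower bound.\<close>

definition mesh_size :: "(real \<Rightarrow> R3 set set) \<Rightarrow> bool" where
  "mesh_size T \<longleftrightarrow> (\<forall>h\<in>{0<..<1}. \<forall>\<tau>\<in>T h. diameter \<tau> \<le> h)"

definition quasi_uniform :: "(real \<Rightarrow> R3 set set) \<Rightarrow> bool" where
  "quasi_uniform T \<longleftrightarrow> (\<exists>\<kappa>>0. \<forall>h\<in>{0<..<1}. \<forall>\<tau>\<in>T h. \<kappa> * h \<le> diameter \<tau>)"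

definition shape_regular :: "(real \<Rightarrow> R3 set set) \<Rightarrow> bool" where
  "shape_regular T \<longleftrightarrow>
     (\<exists>\<sigma>>0. \<forall>h\<in>{0<..<1}. \<forall>\<tau>\<in>T h. \<exists>c. cball c (\<sigma> * diameter \<tau>) \<subseteq> \<tau>)"


section \<open>Finite element spaces and the discrete Green's function\<close>

text \<open>Only the values on the closed domain \<open>\<Union>\<T>\<close> are constrained.\<close>

definition V_h :: "R3 set set \<Rightarrow> (R3 \<Rightarrow> real) set" where
  "V_h \<T> = {v. continuous_on (\<Union>\<T>) v \<and> (\<forall>\<tau>\<in>\<T>. \<exists>a b. \<forall>x\<in>\<tau>. v x = a \<bullet> x + b)}"

text \<open>Vanishing outside the open set \<open>mesh_domain \<T>\<close> combines the zero boundary values and the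
  extension by zero.\<close>

definition V_h0 :: "R3 set set \<Rightarrow> (R3 \<Rightarrow> real) set" where
  "V_h0 \<T> = {v \<in> V_h \<T>. \<forall>x. x \<notin> mesh_domain \<T> \<longrightarrow> v x = 0}"

text \<open>For \<open>v \<in> V_h0 \<T>\<close> this is defined classically off the null set of cell boundaries, and
  represents the weak gradient of \<open>v\<close>.\<close>

definition grad :: "(R3 \<Rightarrow> real) \<Rightarrow> R3 \<Rightarrow> R3" where
  "grad f x = (if \<exists>D. GDERIV f x :> D then THE D. GDERIV f x :> D else 0)"

definition L2_inner :: "R3 set \<Rightarrow> (R3 \<Rightarrow> R3) \<Rightarrow> (R3 \<Rightarrow> R3) \<Rightarrow> real" where
  "L2_inner \<Omega> F G = (LINT x:\<Omega>|lebesgue. F x \<bullet> G x)"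

definition discrete_green :: "R3 set \<Rightarrow> R3 set set \<Rightarrow> R3 \<Rightarrow> R3 \<Rightarrow> real" where
  "discrete_green \<Omega> \<T> z =
     (THE G. G \<in> V_h0 \<T> \<and> (\<forall>v\<in>V_h0 \<T>. L2_inner \<Omega> (grad G) (grad v) = v z))"

definition Lp_norm :: "ennreal \<Rightarrow> R3 set \<Rightarrow> (R3 \<Rightarrow> R3) \<Rightarrow> ennreal" where
  "Lp_norm p D F =
     (if p = \<infinity> then esssup (lebesgue_on D) (\<lambda>x. ennreal (norm (F x)))
      else let I = \<integral>\<^sup>+ x. ennreal (norm (F x) powr enn2real p) \<partial>lebesgue_on D
           in if I = \<infinity> then \<infinity> else ennreal (enn2real I powr (1 / enn2real p)))"

end

theory Submission
  imports Defs
begin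

text \<open>The bound follows from an energy argument on the finite element space alone; no comparison with a
continuous Green's function is made. Testing the defining equation of \<open>G = G\<^sub>h\<^sup>z\<close>
with \<open>G\<close> itself gives \<open>\<parallel>\<nabla>G\<parallel>\<^sup>2 = G z\<close> in the \<open>L\<^sup>2\<close> norm, so the case \<open>p = 2\<close>
is the discrete Sobolev inequality \<open>\<bar>v z\<bar> \<le> C h\<^bsup>-1/2\<^esup> \<parallel>\<nabla>v\<parallel>\<close> for finite element functions
(\<open>discrete_sobolev\<close>). The case \<open>p = \<infinity>\<close> follows by adding the inverse estimate
\<open>\<bar>\<nabla>v\<bar> \<le> C h\<^bsup>-3/2\<^esup> \<parallel>\<nabla>v\<parallel>\<close> (\<open>inverse_estimate\<close>), and
\<open>\<integral>\<bar>F\<bar>\<^sup>p \<le> (sup \<bar>F\<bar>)\<^bsup>p-2\<^esup> \<integral>\<bar>F\<bar>\<^sup>2\<close> interpolates between the two (\<open>Lp_norm_interpolation\<close>).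

The discrete Sobolev inequality rests on averages over growing balls. Write \<open>m t\<close> for the integral of
\<open>v (c + t w)\<close> over the unit ball in \<open>w\<close>. Its derivative is the integral of \<open>w \<bullet> \<nabla>v (c + t w)\<close>, and
since dilation by \<open>t\<close> scales volume by \<open>t\<^sup>3\<close>, the Cauchy--Schwarz inequality bounds it by a multiple of
\<open>t\<^bsup>-3/2\<^esup> \<parallel>\<nabla>v\<parallel>\<close>. The support of \<open>v\<close> is bounded, so \<open>m\<close> vanishes at infinity, and integrating
from \<open>\<rho>\<close> to infinity gives \<open>\<bar>m \<rho>\<bar> \<le> C \<rho>\<^bsup>-1/2\<^esup> \<parallel>\<nabla>v\<parallel>\<close> (\<open>ball_average_le\<close>). If the ball of radius
\<open>\<rho>\<close>, comparable to \<open>h\<close>, lies in the cell that contains \<open>z\<close>, then \<open>v\<close> is affine on it, so \<open>m \<rho>\<close> is a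
multiple of \<open>v c\<close>, and \<open>v z - v c\<close> is at most the cell diameter times the slope, which the inverse
estimate controls.

The discrete Green's function is defined by a definite description, so its existence has to be proved
as well. The energy form is definite by the Sobolev inequality, and a finite element function is
determined by its values at the mesh vertices; \<open>riesz_finitely_many_values\<close> then yields the
representer.\<close>

section \<open>Averages of Lipschitz functions over growing balls\<close>

lemma integral_dilation_lborel:
  fixes f :: "'a::euclidean_space \<Rightarrow> real"
  assumes c: "c \<noteq> 0" and f: "integrable lborel f"
  shows "(\<integral>x. f (t + c *\<^sub>R x) \<partial>lborel) = (\<integral>x. f x \<partial>lborel) / \<bar>c\<bar> ^ DIM('a)"
    (is "?A = _")
    and "integrable lborel (\<lambda>x. f (t + c *\<^sub>R x))" (is ?I)
proof -
  let ?D = "distr lborel borel (\<lambda>x::'a. t + c *\<^sub>R x)" and ?k = "\<bar>c\<bar> ^ DIM('a)"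
  have L: "lborel = density ?D (\<lambda>_. ennreal ?k)"
    using lborel_affine[OF c, of t] by simp
  have pos: "?k > 0" using c by simp
  have [measurable]: "f \<in> borel_measurable borel" using f by (simp add: integrable_iff_bounded)
  have "integrable (density ?D (\<lambda>_. ennreal ?k)) f"
    using f L by simp
  then have "integrable ?D (\<lambda>x. ?k *\<^sub>R f x)"
    by (subst (asm) integrable_density) auto
  then have "integrable lborel (\<lambda>x. ?k *\<^sub>R f (t + c *\<^sub>R x))"
    by (subst (asm) integrable_distr_eq) auto
  then show ?I using pos by simp
  have "(\<integral>x. f x \<partial>lborel) = (\<integral>x. f x \<partial>density ?D (\<lambda>_. ennreal ?k))"
    using L by simp
  also have "\<dots> = (\<integral>x. ?k *\<^sub>R f x \<partial>?D)"
    by (subst integral_density) auto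
  also have "\<dots> = (\<integral>x. ?k *\<^sub>R f (t + c *\<^sub>R x) \<partial>lborel)"
    by (subst integral_distr) auto
  finally show "?A = (\<integral>x. f x \<partial>lborel) / ?k" using pos by simp
qed

lemma null_set_dilation_preimage:
  fixes N :: "'a::euclidean_space set"
  assumes c: "c \<noteq> 0" and N: "N \<in> null_sets lborel"
  shows "AE x in lborel. t + c *\<^sub>R x \<notin> N"
proof -
  let ?D = "distr lborel borel (\<lambda>x::'a. t + c *\<^sub>R x)" and ?k = "\<bar>c\<bar> ^ DIM('a)"
  have L: "lborel = density ?D (\<lambda>_. ennreal ?k)"
    using lborel_affine[OF c, of t] by simp
  have [measurable]: "N \<in> sets borel" using N by (simp add: null_sets_def)
  have "AE x in lborel. x \<notin> N" using N by (rule AE_not_in)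
  then have "AE x in density ?D (\<lambda>_. ennreal ?k). x \<notin> N" using L by metis
  then have "AE x in ?D. x \<notin> N" using c by (subst (asm) AE_density) auto
  then show ?thesis by (subst (asm) AE_distr_iff) auto
qed

text \<open>The right-hand side of the derivative bound is minus the derivative of \<open>C / sqrt t\<close>; hence both
\<open>m t + C / sqrt t\<close> and \<open>- m t + C / sqrt t\<close> are nonincreasing, and they tend to \<open>0\<close>.\<close>

lemma decay_of_derivative_bound:
  fixes m m' :: "real \<Rightarrow> real"
  assumes der: "\<And>t. t > 0 \<Longrightarrow> (m has_real_derivative m' t) (at t)"
    and bd: "\<And>t. t > 0 \<Longrightarrow> \<bar>m' t\<bar> \<le> C / (2 * sqrt t ^ 3)"
    and lim: "(m \<longlongrightarrow> 0) at_top" and "\<rho> > 0"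
  shows "\<bar>m \<rho>\<bar> \<le> C / sqrt \<rho>"
proof -
  have one_sided: "0 \<le> n \<rho> + C / sqrt \<rho>"
    if der: "\<And>t. t > 0 \<Longrightarrow> (n has_real_derivative n' t) (at t)"
      and bd: "\<And>t. t > 0 \<Longrightarrow> n' t \<le> C / (2 * sqrt t ^ 3)"
      and lim: "(n \<longlongrightarrow> 0) at_top" for n n' :: "real \<Rightarrow> real"
  proof (rule tendsto_upperbound)
    have "((\<lambda>t. C / sqrt t) \<longlongrightarrow> 0) at_top"
      by (intro tendsto_divide_0[OF tendsto_const] filterlim_at_top_imp_at_infinity sqrt_at_top)
    from tendsto_add[OF lim this] show "((\<lambda>t. n t + C / sqrt t) \<longlongrightarrow> 0) at_top" by simp
    have "n t + C / sqrt t \<le> n \<rho> + C / sqrt \<rho>" if "\<rho> \<le> t" for t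
    proof (rule DERIV_nonpos_imp_nonincreasing[OF that])
      fix x assume "\<rho> \<le> x"
      then have x: "x > 0" using \<open>\<rho> > 0\<close> by simp
      have "((\<lambda>t. C / sqrt t) has_real_derivative - (C / (2 * sqrt x ^ 3))) (at x)"
        using x by (auto intro!: derivative_eq_intros simp: field_simps power3_eq_cube)
      from DERIV_add[OF der[OF x] this] bd[OF x]
      show "\<exists>y. ((\<lambda>t. n t + C / sqrt t) has_real_derivative y) (at x) \<and> y \<le> 0"
        by (intro exI conjI) auto
    qed
    then show "\<forall>\<^sub>F t in at_top. n t + C / sqrt t \<le> n \<rho> + C / sqrt \<rho>"
      by (intro eventually_mono[OF eventually_ge_at_top[of \<rho>]])
  qed simp
  have "m' t \<le> C / (2 * sqrt t ^ 3)" "- m' t \<le> C / (2 * sqrt t ^ 3)" if "t > 0" for t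
    using bd[OF that] by auto
  then have "0 \<le> m \<rho> + C / sqrt \<rho>" "0 \<le> - m \<rho> + C / sqrt \<rho>"
    using one_sided[of m m', OF der _ lim] tendsto_minus[OF lim]
      one_sided[of "\<lambda>t. - m t" "\<lambda>t. - m' t", OF DERIV_minus[OF der]] by auto
  then show ?thesis by linarith
qed

text \<open>This is the Sobolev-type estimate behind the pointwise bound. With \<open>m t\<close> the integral of
\<open>v (c + t w)\<close> over the unit ball, dominated convergence differentiates under the integral: the
difference quotients are bounded by the Lipschitz constant and converge off a dilate of \<open>N\<close>. The
exponent of \<open>\<rho>\<close> comes from the dimension: the change of variables turns the squared \<open>L\<^sup>2\<close> norm of
\<open>w \<mapsto> D (c + t w)\<close> into \<open>t\<^bsup>-3\<^esup>\<close> times that of \<open>D\<close>, and \<open>t\<^bsup>-3/2\<^esup>\<close> is integrable at infinity.\<close>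

lemma ball_average_le:
  fixes v :: "R3 \<Rightarrow> real" and D :: "R3 \<Rightarrow> R3"
  assumes lip: "L-lipschitz_on UNIV v"
    and supp: "\<And>x. x \<notin> cball 0 R \<Longrightarrow> v x = 0"
    and N: "N \<in> null_sets lborel"
    and D[measurable]: "D \<in> borel_measurable borel" and grad: "\<And>x. x \<notin> N \<Longrightarrow> GDERIV v x :> D x"
    and int: "integrable lborel (\<lambda>x. (norm (D x))\<^sup>2)"
    and S: "(\<integral>x. (norm (D x))\<^sup>2 \<partial>lborel) \<le> S\<^sup>2" "S > 0" and "\<rho> > 0"
  shows "\<bar>\<integral>w. indicat_real (ball 0 1) w * v (c + \<rho> *\<^sub>R w) \<partial>lborel\<bar>
           \<le> (1 + measure lborel (ball (0::R3) 1)) * S / sqrt \<rho>"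
proof -
  let ?B = "ball (0::R3) 1"
  have [measurable]: "?B \<in> sets borel" by simp
  have Dt[measurable]: "(\<lambda>w. D (c + t *\<^sub>R w)) \<in> borel_measurable borel" for t
    by (rule measurable_compose[OF _ D]) measurable
  have [measurable]: "(\<lambda>w. w \<bullet> D (c + t *\<^sub>R w)) \<in> borel_measurable borel" for t
    by (rule borel_measurable_inner) (simp_all add: Dt)
  have iB: "integrable lborel (indicat_real ?B)"
    by (intro integrable_real_indicator emeasure_lborel_ball_finite) auto
  define m where "m t = (\<integral>w. indicat_real ?B w * v (c + t *\<^sub>R w) \<partial>lborel)" for t
  define m' where "m' t = (\<integral>w. indicat_real ?B w * (w \<bullet> D (c + t *\<^sub>R w)) \<partial>lborel)" for t
  have "continuous_on UNIV v" by (rule lipschitz_on_continuous_on[OF lip])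
  then have [measurable]: "v \<in> borel_measurable borel" by (rule borel_measurable_continuous_onI)
  have iv: "integrable lborel v"
  proof -
    have "integrable lborel (\<lambda>x. indicator (cball 0 R) x *\<^sub>R v x)"
      by (rule borel_integrable_compact)
        (use \<open>continuous_on UNIV v\<close> continuous_on_subset in auto)
    moreover have "(\<lambda>x. indicator (cball 0 R) x *\<^sub>R v x) = v"
      using supp by (intro ext) (auto simp: indicator_def)
    ultimately show ?thesis by simp
  qed
  have im: "integrable lborel (\<lambda>w. indicat_real ?B w * v (c + t *\<^sub>R w))" for t
  proof (cases "t = 0")
    case True then show ?thesis using iB by simp
  next
    case False
    from integral_dilation_lborel(2)[OF this iv, of c] show ?thesis
      using integrable_real_mult_indicator[of ?B lborel "\<lambda>w. v (c + t *\<^sub>R w)"]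
      by (simp add: mult.commute)
  qed
  have der: "(m has_real_derivative m' t) (at t)" if t: "t > 0" for t
    unfolding DERIV_def tendsto_at_iff_sequentially
  proof (intro allI impI)
    fix X :: "nat \<Rightarrow> real" assume X: "\<forall>i. X i \<in> UNIV - {0}" "X \<longlonglongrightarrow> 0"
    define q where "q i w = indicat_real ?B w * ((v (c + (t + X i) *\<^sub>R w) - v (c + t *\<^sub>R w)) / X i)" for i w
    have "(m (t + X i) - m t) / X i = (\<integral>w. q i w \<partial>lborel)" for i
    proof -
      have "m (t + X i) - m t = (\<integral>w. indicat_real ?B w * v (c + (t + X i) *\<^sub>R w)
               - indicat_real ?B w * v (c + t *\<^sub>R w) \<partial>lborel)"
        unfolding m_def by (rule Bochner_Integration.integral_diff[symmetric]) (rule im)+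
      then have "(m (t + X i) - m t) / X i = (\<integral>w. (indicat_real ?B w * v (c + (t + X i) *\<^sub>R w)
               - indicat_real ?B w * v (c + t *\<^sub>R w)) / X i \<partial>lborel)" by simp
      also have "\<dots> = (\<integral>w. q i w \<partial>lborel)"
        unfolding q_def by (intro Bochner_Integration.integral_cong) (auto simp: algebra_simps)
      finally show ?thesis .
    qed
    moreover have "(\<lambda>i. \<integral>w. q i w \<partial>lborel) \<longlonglongrightarrow> m' t"
      unfolding m'_def
    proof (rule integral_dominated_convergence)
      show "AE w in lborel. (\<lambda>i. q i w) \<longlonglongrightarrow> indicat_real ?B w * (w \<bullet> D (c + t *\<^sub>R w))"
        using null_set_dilation_preimage[OF _ N, of t c]
      proof (rule AE_mp)
        show "t \<noteq> 0" using t by simp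
        show "AE w in lborel. c + t *\<^sub>R w \<notin> N \<longrightarrow>
           (\<lambda>i. q i w) \<longlonglongrightarrow> indicat_real ?B w * (w \<bullet> D (c + t *\<^sub>R w))"
        proof (intro AE_I2 impI)
          fix w assume "c + t *\<^sub>R w \<notin> N"
          then have "(v has_derivative (\<lambda>h. h \<bullet> D (c + t *\<^sub>R w))) (at (c + t *\<^sub>R w))"
            using grad by (simp add: gderiv_def)
          then have "((\<lambda>s. v (c + s *\<^sub>R w)) has_derivative (\<lambda>h. (h *\<^sub>R w) \<bullet> D (c + t *\<^sub>R w))) (at t)"
            by (intro has_derivative_compose[of "\<lambda>s. c + s *\<^sub>R w" "\<lambda>h. h *\<^sub>R w" t UNIV v])
               (auto intro!: derivative_eq_intros)
          then have "((\<lambda>s. v (c + s *\<^sub>R w)) has_real_derivative (w \<bullet> D (c + t *\<^sub>R w))) (at t)"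
            by (rule has_derivative_imp_has_field_derivative) (simp add: mult.commute)
          then have "(\<lambda>i. (v (c + (t + X i) *\<^sub>R w) - v (c + t *\<^sub>R w)) / X i) \<longlonglongrightarrow> w \<bullet> D (c + t *\<^sub>R w)"
            using X unfolding DERIV_def tendsto_at_iff_sequentially comp_def by blast
          then show "(\<lambda>i. q i w) \<longlonglongrightarrow> indicat_real ?B w * (w \<bullet> D (c + t *\<^sub>R w))"
            unfolding q_def by (intro tendsto_mult tendsto_const)
        qed
      qed
      show "(\<lambda>w. indicat_real ?B w * (w \<bullet> D (c + t *\<^sub>R w))) \<in> borel_measurable lborel"
        by simp
      show "q i \<in> borel_measurable lborel" for i
        unfolding q_def by measurable
      show "integrable lborel (\<lambda>w. L * indicat_real ?B w)" using iB by simp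
      show "AE w in lborel. norm (q i w) \<le> L * indicat_real ?B w" for i
      proof (rule AE_I2)
        fix w
        have "\<bar>v (c + (t + X i) *\<^sub>R w) - v (c + t *\<^sub>R w)\<bar> \<le> L * (\<bar>X i\<bar> * norm w)"
          using lipschitz_onD[OF lip, of "c + (t + X i) *\<^sub>R w" "c + t *\<^sub>R w"]
          by (simp add: dist_norm algebra_simps)
        moreover have "L * (\<bar>X i\<bar> * norm w) \<le> L * \<bar>X i\<bar>" if "w \<in> ?B"
          using that lipschitz_on_nonneg[OF lip] by (intro mult_left_mono mult_left_le) auto
        ultimately show "norm (q i w) \<le> L * indicat_real ?B w"
          using X(1) by (auto simp: q_def indicator_def abs_mult divide_le_eq)
      qed
    qed
    ultimately show "((\<lambda>h. (m (t + h) - m t) / h) \<circ> X) \<longlonglongrightarrow> m' t"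
      by (simp add: comp_def)
  qed
  have bd: "\<bar>m' t\<bar> \<le> ((1 + measure lborel ?B) * S) / (2 * sqrt t ^ 3)" if t: "t > 0" for t
  proof -
    (* k is the weight in d <= k/2 d^2 + 1/(2k); this choice balances the two integrated terms. *)
    define k where "k = sqrt t ^ 3 / S"
    have k: "k > 0" using t S by (simp add: k_def)
    have t3: "t ^ 3 = (sqrt t ^ 3)\<^sup>2"
      using t by (metis power_mult mult.commute real_sqrt_pow2 less_imp_le)
    note dil = integral_dilation_lborel[OF _ int, of t c]
    have i1: "integrable lborel (\<lambda>w. k / 2 * (norm (D (c + t *\<^sub>R w)))\<^sup>2 + indicat_real ?B w / (2 * k))"
      using dil(2) t iB by auto
    have "\<bar>m' t\<bar> \<le> (\<integral>w. k / 2 * (norm (D (c + t *\<^sub>R w)))\<^sup>2 + indicat_real ?B w / (2 * k) \<partial>lborel)"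
      unfolding m'_def real_norm_def[symmetric]
    proof (rule Bochner_Integration.integral_norm_bound_integral[OF _ i1])
      have pt: "norm (indicat_real ?B w * (w \<bullet> D (c + t *\<^sub>R w)))
          \<le> k / 2 * (norm (D (c + t *\<^sub>R w)))\<^sup>2 + indicat_real ?B w / (2 * k)" for w
      proof (cases "w \<in> ?B")
        case True
        let ?d = "norm (D (c + t *\<^sub>R w))"
        have "\<bar>w \<bullet> D (c + t *\<^sub>R w)\<bar> \<le> norm w * ?d" by (rule Cauchy_Schwarz_ineq2)
        also have "\<dots> \<le> ?d" using True by (intro mult_left_le_one_le) auto
        also have "?d \<le> k / 2 * ?d\<^sup>2 + 1 / (2 * k)"
        proof -
          have "0 \<le> (k * ?d - 1)\<^sup>2 / (2 * k)" using k by simp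
          also have "\<dots> = k / 2 * ?d\<^sup>2 + 1 / (2 * k) - ?d"
            using k by (simp add: field_simps power2_eq_square)
          finally show ?thesis by simp
        qed
        finally show ?thesis using True by (simp add: indicator_def)
      qed (use k in \<open>auto simp: indicator_def\<close>)
      show "norm (indicat_real ?B w * (w \<bullet> D (c + t *\<^sub>R w)))
          \<le> k / 2 * (norm (D (c + t *\<^sub>R w)))\<^sup>2 + indicat_real ?B w / (2 * k)" for w
        by (rule pt)
      show "integrable lborel (\<lambda>w. indicat_real ?B w * (w \<bullet> D (c + t *\<^sub>R w)))"
      proof (rule Bochner_Integration.integrable_bound[OF i1])
        show "AE w in lborel. norm (indicat_real ?B w * (w \<bullet> D (c + t *\<^sub>R w)))
          \<le> norm (k / 2 * (norm (D (c + t *\<^sub>R w)))\<^sup>2 + indicat_real ?B w / (2 * k))"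
          by (intro AE_I2 order_trans[OF pt]) simp
      qed simp
    qed
    also have "\<dots> = k / 2 * ((\<integral>x. (norm (D x))\<^sup>2 \<partial>lborel) / t ^ 3) + measure lborel ?B / (2 * k)"
      using dil t iB by simp
    also have "\<dots> \<le> k / 2 * (S\<^sup>2 / t ^ 3) + measure lborel ?B / (2 * k)"
      using S t k by (intro add_right_mono mult_left_mono divide_right_mono) auto
    also have "\<dots> = ((1 + measure lborel ?B) * S) / (2 * sqrt t ^ 3)"
      using t S unfolding t3 k_def by (simp add: field_simps power2_eq_square)
    finally show ?thesis .
  qed
  have lim: "(m \<longlongrightarrow> 0) at_top"
  proof (rule Lim_null_comparison)
    have "\<bar>m t\<bar> \<le> (\<integral>x. \<bar>v x\<bar> \<partial>lborel) / t ^ 3" if t: "t > 0" for t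
    proof -
      note dil = integral_dilation_lborel[of t "\<lambda>x. \<bar>v x\<bar>" c]
      have "\<bar>m t\<bar> \<le> (\<integral>w. \<bar>v (c + t *\<^sub>R w)\<bar> \<partial>lborel)"
        unfolding m_def real_norm_def[symmetric]
        by (rule Bochner_Integration.integral_norm_bound_integral[OF im])
          (use dil t iv in \<open>auto simp: indicator_def\<close>)
      then show ?thesis using dil t iv by simp
    qed
    then show "\<forall>\<^sub>F t in at_top. norm (m t) \<le> (\<integral>x. \<bar>v x\<bar> \<partial>lborel) / t ^ 3"
      by (intro eventually_mono[OF eventually_gt_at_top[of 0]]) simp
    show "((\<lambda>t. (\<integral>x. \<bar>v x\<bar> \<partial>lborel) / t ^ 3) \<longlongrightarrow> 0) at_top"
      by (intro tendsto_divide_0[OF tendsto_const] filterlim_at_top_imp_at_infinity filterlim_pow_at_top filterlim_ident) auto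
  qed
  show ?thesis
    using decay_of_derivative_bound[OF der bd lim \<open>\<rho> > 0\<close>] by (simp add: m_def)
qed

section \<open>Riesz representation on function spaces with finitely many degrees of freedom\<close>

text \<open>Injectivity of the evaluation at the points of \<open>N\<close> makes \<open>V\<close> finite-dimensional without the choice of
a basis, and the representer is built by induction on \<open>N\<close>. The subspace
\<open>V'\<close> of functions vanishing at one of the points is covered by the induction hypothesis. It has
codimension at most one, and a Gram--Schmidt step supplies the missing direction \<open>e\<close>: some \<open>b \<in> V\<close>
outside \<open>V'\<close> minus its orthogonal projection, which is the representer of \<open>A b\<close> on \<open>V'\<close>. By
definiteness, \<open>A e e \<noteq> 0\<close>.\<close>

lemma riesz_finitely_many_values:
  fixes V :: "('a \<Rightarrow> real) set" and A :: "('a \<Rightarrow> real) \<Rightarrow> ('a \<Rightarrow> real) \<Rightarrow> real"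
  assumes "finite N"
    and zero: "(\<lambda>_. 0) \<in> V"
    and add: "\<And>u v. u \<in> V \<Longrightarrow> v \<in> V \<Longrightarrow> (\<lambda>x. u x + v x) \<in> V"
    and scale: "\<And>r u. u \<in> V \<Longrightarrow> (\<lambda>x. r * u x) \<in> V"
    and det: "\<And>v. v \<in> V \<Longrightarrow> (\<forall>x\<in>N. v x = 0) \<Longrightarrow> v = (\<lambda>_. 0)"
    and A_sym: "\<And>u v. u \<in> V \<Longrightarrow> v \<in> V \<Longrightarrow> A u v = A v u"
    and A_add: "\<And>u v w. u \<in> V \<Longrightarrow> v \<in> V \<Longrightarrow> w \<in> V \<Longrightarrow> A (\<lambda>x. u x + v x) w = A u w + A v w"
    and A_scale: "\<And>r u w. u \<in> V \<Longrightarrow> w \<in> V \<Longrightarrow> A (\<lambda>x. r * u x) w = r * A u w"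
    and A_def: "\<And>v. v \<in> V \<Longrightarrow> A v v = 0 \<Longrightarrow> v = (\<lambda>_. 0)"
    and l_add: "\<And>u v. u \<in> V \<Longrightarrow> v \<in> V \<Longrightarrow> l (\<lambda>x. u x + v x) = l u + (l v :: real)"
    and l_scale: "\<And>r u. u \<in> V \<Longrightarrow> l (\<lambda>x. r * u x) = r * l u"
  shows "\<exists>G\<in>V. \<forall>v\<in>V. A G v = l v"
  using assms
proof (induction N arbitrary: V l rule: finite_induct)
  case empty
  then have V: "v = (\<lambda>_. 0)" if "v \<in> V" for v using that by blast
  have "A (\<lambda>_. 0) (\<lambda>_. 0) = 0" "l (\<lambda>_. 0) = 0"
    using empty.prems(7)[of "\<lambda>_. 0" "\<lambda>_. 0" 0] empty.prems(10)[of "\<lambda>_. 0" 0] empty.prems(1) by simp_all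
  then show ?case using V empty.prems(1) by metis
next
  case (insert x N)
  note zero = insert.prems(1) and add = insert.prems(2) and scale = insert.prems(3)
    and A_sym = insert.prems(5) and A_add = insert.prems(6) and A_scale = insert.prems(7)
  define V' where "V' = {v \<in> V. v x = 0}"
  have representer: "\<exists>G\<in>V'. \<forall>v\<in>V'. A G v = l v"
    if l: "\<And>u v. u \<in> V \<Longrightarrow> v \<in> V \<Longrightarrow> l (\<lambda>x. u x + v x) = l u + (l v :: real)"
      and l_sc: "\<And>r u. u \<in> V \<Longrightarrow> l (\<lambda>x. r * u x) = r * l u" for l
  proof (rule insert.IH)
    show "v = (\<lambda>_. 0)" if "v \<in> V'" "\<forall>y\<in>N. v y = 0" for v
      using that insert.prems(4)[of v] by (auto simp: V'_def)
    show "(\<lambda>_. 0) \<in> V'" using zero by (simp add: V'_def)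
    show "(\<lambda>x. u x + v x) \<in> V'" if "u \<in> V'" "v \<in> V'" for u v
      using that add by (simp add: V'_def)
    show "(\<lambda>x. r * u x) \<in> V'" if "u \<in> V'" for r u
      using that scale by (simp add: V'_def)
    show "A u v = A v u" if "u \<in> V'" "v \<in> V'" for u v
      by (rule A_sym) (use that in \<open>simp_all add: V'_def\<close>)
    show "A (\<lambda>x. u x + v x) w = A u w + A v w" if "u \<in> V'" "v \<in> V'" "w \<in> V'" for u v w
      by (rule A_add) (use that in \<open>simp_all add: V'_def\<close>)
    show "A (\<lambda>x. r * u x) w = r * A u w" if "u \<in> V'" "w \<in> V'" for r u w
      by (rule A_scale) (use that in \<open>simp_all add: V'_def\<close>)
    show "v = (\<lambda>_. 0)" if "v \<in> V'" "A v v = 0" for v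
      by (rule insert.prems(8)) (use that in \<open>simp_all add: V'_def\<close>)
    show "l (\<lambda>x. u x + v x) = l u + l v" if "u \<in> V'" "v \<in> V'" for u v
      by (rule l) (use that in \<open>simp_all add: V'_def\<close>)
    show "l (\<lambda>x. r * u x) = r * l u" if "u \<in> V'" for r u
      by (rule l_sc) (use that in \<open>simp_all add: V'_def\<close>)
  qed
  have "\<exists>G\<in>V'. \<forall>v\<in>V'. A G v = l v"
    by (rule representer[of l, OF insert.prems(9) insert.prems(10)])
  then obtain G' where G': "G' \<in> V'" "\<forall>v\<in>V'. A G' v = l v" by (rule bexE)
  show ?case
  proof (cases "\<forall>v\<in>V. v x = 0")
    case True
    then have "V' = V" by (auto simp: V'_def)
    then show ?thesis using G' by blast
  next
    case False
    then have "\<exists>b\<in>V. b x \<noteq> 0" by simp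
    then obtain b where b: "b \<in> V" "b x \<noteq> 0" by (rule bexE)
    have "\<exists>P\<in>V'. \<forall>v\<in>V'. A P v = A b v"
    proof (rule representer)
      show "A b (\<lambda>x. u x + v x) = A b u + A b v" if "u \<in> V" "v \<in> V" for u v
        by (simp only: A_sym[OF b(1) add[OF that]] A_add[OF that b(1)] A_sym[OF b(1) that(1)] A_sym[OF b(1) that(2)])
      show "A b (\<lambda>x. r * u x) = r * A b u" if "u \<in> V" for r u
        by (simp only: A_sym[OF b(1) scale[OF that]] A_scale[OF that b(1)] A_sym[OF b(1) that])
    qed
    then obtain P where P: "P \<in> V'" "\<forall>v\<in>V'. A P v = A b v" by (rule bexE)
    have sub: "v \<in> V" if "v \<in> V'" for v using that by (simp add: V'_def)
    define e where "e = (\<lambda>y. b y + (-1) * P y)"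
    have e: "e \<in> V" unfolding e_def by (intro add scale b sub P)
    have ex: "e x \<noteq> 0" using b P(1) by (simp add: e_def V'_def)
    then have "A e e \<noteq> 0" using insert.prems(8)[OF e] by auto
    have orth: "A e v = 0" if "v \<in> V'" for v
    proof -
      have "A e v = A b v + (-1) * A P v"
        unfolding e_def
        by (simp only: A_add[OF b(1) scale[OF sub[OF P(1)]] sub[OF that]] A_scale[OF sub[OF P(1)] sub[OF that]])
      then show ?thesis using P(2) that by simp
    qed
    define r where "r = l e / A e e"
    define G where "G = (\<lambda>y. G' y + r * e y)"
    have GV: "G \<in> V" unfolding G_def by (intro add scale e sub G')
    have AG: "A G v = A G' v + r * A e v" if "v \<in> V" for v
      unfolding G_def by (simp only: A_add[OF sub[OF G'(1)] scale[OF e] that] A_scale[OF e that])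
    have "A G v = l v" if v: "v \<in> V" for v
    proof -
      define s where "s = v x / e x"
      define u where "u = (\<lambda>y. v y + (-s) * e y)"
      have uV: "u \<in> V" unfolding u_def by (intro add scale e v)
      have u: "u \<in> V'" using uV ex by (simp add: V'_def u_def s_def)
      have v_eq: "v = (\<lambda>y. u y + s * e y)" by (simp add: u_def)
      have "A G v = A v G" by (rule A_sym[OF GV v])
      also have "A v G = A (\<lambda>y. u y + s * e y) G" using v_eq by (rule arg_cong)
      also have "\<dots> = A u G + s * A e G"
        by (simp only: A_add[OF uV scale[OF e] GV] A_scale[OF e GV])
      also have "\<dots> = A G u + s * A G e"
        by (simp only: A_sym[OF GV uV] A_sym[OF GV e])
      also have "A G u = l u" using AG[OF uV] G'(2) u orth[OF u] by simp
      also have "A G e = l e"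
        using AG[OF e] orth[OF G'(1)] A_sym[OF e sub[OF G'(1)]] \<open>A e e \<noteq> 0\<close> by (simp add: r_def)
      also have "l u + s * l e = l (\<lambda>y. u y + s * e y)"
        by (simp only: insert.prems(9)[OF uV scale[OF e]] insert.prems(10)[OF e])
      also have "\<dots> = l v" using v_eq[symmetric] by (rule arg_cong)
      finally show ?thesis .
    qed
    then show ?thesis using GV by blast
  qed
qed

section \<open>Piecewise gradients of finite element functions\<close>

lemma grad_eqI:
  assumes "GDERIV f x :> D" shows "grad f x = D"
proof -
  have "D' = D" if "GDERIV f x :> D'" for D'
  proof -
    have "(\<lambda>h. h \<bullet> D') = (\<lambda>h. h \<bullet> D)"
      using has_derivative_unique[of f _ x] that assms by (simp add: gderiv_def)
    then show ?thesis by (metis inner_commute vector_eq_rdot)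
  qed
  then show ?thesis using assms unfolding grad_def by (metis the_equality)
qed

lemma measurable_lebesgue_AE_eq:
  fixes f g :: "'a::euclidean_space \<Rightarrow> 'b::topological_space"
  assumes g: "g \<in> borel_measurable borel" and ae: "AE x in lborel. f x = g x"
  shows "f \<in> borel_measurable lebesgue"
proof (rule measurableI)
  fix A :: "'b set" assume A: "A \<in> sets borel"
  have gA: "g -` A \<inter> space lebesgue \<in> sets lebesgue"
    by (rule measurable_sets[OF measurable_completion A]) (use g in simp)
  have "AE x in lebesgue. x \<in> g -` A \<inter> space lebesgue \<longleftrightarrow> x \<in> f -` A \<inter> space lebesgue"
    using AE_completion[OF ae] by eventually_elim auto
  from completion.in_sets_AE[OF this gA] show "f -` A \<inter> space lebesgue \<in> sets lebesgue" by simp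
qed simp

definition mesh_skeleton :: "R3 set set \<Rightarrow> R3 set" where
  "mesh_skeleton \<T> = (\<Union>\<tau>\<in>\<T>. frontier \<tau>)"

text \<open>The gradient with an arbitrary value on the null set where finite element functions may have kinks. Unlike
\<open>grad\<close>, it is Borel measurable and, on finite element functions, linear at every point.\<close>

definition mesh_grad :: "R3 set set \<Rightarrow> (R3 \<Rightarrow> real) \<Rightarrow> R3 \<Rightarrow> R3" where
  "mesh_grad \<T> v x = (if x \<in> mesh_skeleton \<T> then 0 else grad v x)"

lemma tet_mesh_finite: "tet_mesh \<T> \<Longrightarrow> finite \<T>"
  by (simp add: tet_mesh_def triangulation_def)

lemma tet_mesh_cell:
  assumes "tet_mesh \<T>" "\<tau> \<in> \<T>"
  shows "compact \<tau>" "closed \<tau>" "convex \<tau>" "bounded \<tau>"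
proof -
  have "3 simplex \<tau>" using assms by (simp add: tet_mesh_def)
  then show "compact \<tau>" "closed \<tau>" "convex \<tau>" "bounded \<tau>"
    by (simp_all add: compact_simplex closed_simplex convex_simplex compact_imp_bounded)
qed

lemma tet_mesh_Union:
  assumes "tet_mesh \<T>" shows "compact (\<Union>\<T>)" "closed (\<Union>\<T>)"
proof -
  show "compact (\<Union>\<T>)"
    using compact_Union[of \<T>] tet_mesh_finite tet_mesh_cell assms by blast
  then show "closed (\<Union>\<T>)" by (rule compact_imp_closed)
qed

lemma closed_mesh_skeleton: "tet_mesh \<T> \<Longrightarrow> closed (mesh_skeleton \<T>)"
  unfolding mesh_skeleton_def by (intro closed_UN) (auto dest: tet_mesh_finite)

lemma null_mesh_skeleton:
  assumes "tet_mesh \<T>" shows "mesh_skeleton \<T> \<in> null_sets lborel"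
proof -
  have "negligible (mesh_skeleton \<T>)"
    unfolding mesh_skeleton_def
    using tet_mesh_finite[OF assms] negligible_convex_frontier tet_mesh_cell(3)[OF assms]
    by (intro negligible_Union) auto
  then show ?thesis
    using closed_mesh_skeleton[OF assms]
    by (simp add: negligible_iff_null_sets null_sets_completion_iff)
qed

lemma off_skeleton_cases:
  assumes "x \<notin> mesh_skeleton \<T>"
  obtains (inside) \<tau> where "\<tau> \<in> \<T>" "x \<in> interior \<tau>" | (outside) "x \<notin> \<Union>\<T>"
proof (cases "x \<in> \<Union>\<T>")
  case True
  then obtain \<tau> where "\<tau> \<in> \<T>" "x \<in> \<tau>" by auto
  then have "x \<in> interior \<tau>"
    using assms closure_subset[of \<tau>] by (auto simp: mesh_skeleton_def frontier_def)
  then show thesis using inside \<open>\<tau> \<in> \<T>\<close> by blast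
qed (use outside in blast)

lemma interior_cell_subset: "\<tau> \<in> \<T> \<Longrightarrow> interior \<tau> \<subseteq> mesh_domain \<T>"
  unfolding mesh_domain_def by (intro interior_mono) auto

lemma V_h0_outside: "v \<in> V_h0 \<T> \<Longrightarrow> x \<notin> mesh_domain \<T> \<Longrightarrow> v x = 0"
  by (simp add: V_h0_def)

lemma gderiv_affine_on_open:
  assumes "open U" "x \<in> U" "\<And>y. y \<in> U \<Longrightarrow> f y = a \<bullet> y + b"
  shows "GDERIV f x :> a"
proof -
  have "((\<lambda>y. a \<bullet> y + b) has_derivative (\<lambda>h. h \<bullet> a)) (at x)"
    by (auto intro!: derivative_eq_intros simp: inner_commute)
  then have "(f has_derivative (\<lambda>h. h \<bullet> a)) (at x)"
    by (rule has_derivative_transform_within_open[OF _ assms(1,2)]) (simp add: assms(3))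
  then show ?thesis by (simp add: gderiv_def)
qed

lemma V_h0_gderiv_outside:
  assumes "tet_mesh \<T>" "v \<in> V_h0 \<T>" "x \<notin> \<Union>\<T>"
  shows "GDERIV v x :> 0"
proof (rule gderiv_affine_on_open[where U="- \<Union>\<T>" and b=0])
  show "open (- \<Union>\<T>)" using tet_mesh_Union[OF assms(1)] by (simp add: open_Compl)
  show "v y = 0 \<bullet> y + 0" if "y \<in> - \<Union>\<T>" for y
    using that V_h0_outside[OF assms(2)] interior_subset[of "\<Union>\<T>"] by (auto simp: mesh_domain_def)
qed (use assms in auto)

lemma V_h0_affine_on_cell: "v \<in> V_h0 \<T> \<Longrightarrow> \<tau> \<in> \<T> \<Longrightarrow> \<exists>a b. \<forall>x\<in>\<tau>. v x = a \<bullet> x + b"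
  by (simp add: V_h0_def V_h_def)

lemma V_h0_cellwise_affine:
  assumes "v \<in> V_h0 \<T>"
  shows "\<exists>a b. \<forall>\<tau>\<in>\<T>. (\<forall>x\<in>\<tau>. v x = a \<tau> \<bullet> x + b \<tau>) \<and> (\<forall>x\<in>interior \<tau>. GDERIV v x :> a \<tau>)"
proof -
  have "\<forall>\<tau>\<in>\<T>. \<exists>a b. \<forall>x\<in>\<tau>. v x = a \<bullet> x + b"
    using V_h0_affine_on_cell[OF assms] by blast
  then obtain a b where ab: "\<forall>\<tau>\<in>\<T>. \<forall>x\<in>\<tau>. v x = a \<tau> \<bullet> x + b \<tau>" by metis
  have "GDERIV v x :> a \<tau>" if "\<tau> \<in> \<T>" "x \<in> interior \<tau>" for \<tau> x
    by (rule gderiv_affine_on_open[of "interior \<tau>" _ _ _ "b \<tau>"])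
      (use that ab interior_subset in auto)
  with ab show ?thesis by blast
qed

lemma V_h0_gderiv:
  assumes "tet_mesh \<T>" "v \<in> V_h0 \<T>" "x \<notin> mesh_skeleton \<T>"
  shows "GDERIV v x :> mesh_grad \<T> v x"
proof -
  obtain a b where cell: "\<forall>\<tau>\<in>\<T>. (\<forall>x\<in>\<tau>. v x = a \<tau> \<bullet> x + b \<tau>) \<and> (\<forall>x\<in>interior \<tau>. GDERIV v x :> a \<tau>)"
    using V_h0_cellwise_affine[OF assms(2)] by blast
  then have a: "\<And>\<tau> x. \<tau> \<in> \<T> \<Longrightarrow> x \<in> interior \<tau> \<Longrightarrow> GDERIV v x :> a \<tau>"
    and ab: "\<And>\<tau> x. \<tau> \<in> \<T> \<Longrightarrow> x \<in> \<tau> \<Longrightarrow> v x = a \<tau> \<bullet> x + b \<tau>" by simp_all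
  have "\<exists>D. GDERIV v x :> D"
    using assms(3)
  proof (cases rule: off_skeleton_cases)
    case (inside \<tau>) then show ?thesis using a by blast
  next
    case outside then show ?thesis using V_h0_gderiv_outside assms by blast
  qed
  then show ?thesis using assms(3) by (auto simp: mesh_grad_def grad_eqI)
qed

lemma mesh_grad_eqI:
  "x \<notin> mesh_skeleton \<T> \<Longrightarrow> GDERIV v x :> D \<Longrightarrow> mesh_grad \<T> v x = D"
  by (simp add: mesh_grad_def grad_eqI)

lemma mesh_grad_outside:
  "tet_mesh \<T> \<Longrightarrow> v \<in> V_h0 \<T> \<Longrightarrow> x \<notin> \<Union>\<T> \<Longrightarrow> mesh_grad \<T> v x = 0"
  by (simp add: mesh_grad_def grad_eqI V_h0_gderiv_outside)

text \<open>Two points are joined by a segment. The cells, together with the complement of the open mesh domain,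
cut it into finitely many closed pieces, on each of which \<open>v\<close> is Lipschitz with the sum of the
slopes of all cells as a common constant; on closed pieces covering an interval, Lipschitz bounds glue.\<close>

lemma V_h0_lipschitz:
  assumes T: "tet_mesh \<T>" and v: "v \<in> V_h0 \<T>"
  obtains L where "L-lipschitz_on UNIV v"
proof -
  obtain a b where cell: "\<forall>\<tau>\<in>\<T>. (\<forall>x\<in>\<tau>. v x = a \<tau> \<bullet> x + b \<tau>) \<and> (\<forall>x\<in>interior \<tau>. GDERIV v x :> a \<tau>)"
    using V_h0_cellwise_affine[OF v] by blast
  then have a: "\<And>\<tau> x. \<tau> \<in> \<T> \<Longrightarrow> x \<in> interior \<tau> \<Longrightarrow> GDERIV v x :> a \<tau>"
    and ab: "\<And>\<tau> x. \<tau> \<in> \<T> \<Longrightarrow> x \<in> \<tau> \<Longrightarrow> v x = a \<tau> \<bullet> x + b \<tau>" by simp_all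
  define L where "L = (\<Sum>\<tau>\<in>\<T>. norm (a \<tau>))"
  have L: "norm (a \<tau>) \<le> L" if "\<tau> \<in> \<T>" for \<tau>
    unfolding L_def using tet_mesh_finite[OF T] that by (intro member_le_sum) auto
  have "0 \<le> L" by (simp add: L_def sum_nonneg)
  have "dist (v x) (v y) \<le> L * dist x y" for x y
  proof -
    define \<phi> where "\<phi> s = x + s *\<^sub>R (y - x)" for s :: real
    define M where "M = L * norm (y - x)"
    have "0 \<le> M" using \<open>0 \<le> L\<close> by (simp add: M_def)
    have "M-lipschitz_on {0..1} (v \<circ> \<phi>)"
    proof (rule lipschitz_on_closed_Union[where U="\<lambda>S. \<phi> -` S" and I="insert (- mesh_domain \<T>) \<T>"])
      fix S assume S: "S \<in> insert (- mesh_domain \<T>) \<T>"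
      then consider "S = - mesh_domain \<T>" | "S \<in> \<T>" by auto
      then show "M-lipschitz_on (\<phi> -` S) (v \<circ> \<phi>)"
      proof cases
        case 1
        then show ?thesis
          using \<open>0 \<le> M\<close> V_h0_outside[OF v] by (intro lipschitz_onI) auto
      next
        case 2
        have "dist (v (\<phi> s)) (v (\<phi> t)) \<le> M * dist s t" if "\<phi> s \<in> S" "\<phi> t \<in> S" for s t
        proof -
          have "v (\<phi> s) - v (\<phi> t) = a S \<bullet> (\<phi> s - \<phi> t)"
            by (simp add: ab[OF 2 that(1)] ab[OF 2 that(2)] inner_diff_right)
          also have "\<phi> s - \<phi> t = (s - t) *\<^sub>R (y - x)"
            by (simp add: \<phi>_def algebra_simps)
          finally have "v (\<phi> s) - v (\<phi> t) = (s - t) * (a S \<bullet> (y - x))" by simp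
          then have "dist (v (\<phi> s)) (v (\<phi> t)) = \<bar>s - t\<bar> * \<bar>a S \<bullet> (y - x)\<bar>"
            by (simp add: dist_real_def abs_mult)
          also have "\<dots> \<le> \<bar>s - t\<bar> * (norm (a S) * norm (y - x))"
            by (intro mult_left_mono Cauchy_Schwarz_ineq2) auto
          also have "\<dots> \<le> \<bar>s - t\<bar> * M"
            unfolding M_def using L[OF 2] by (intro mult_left_mono mult_right_mono) auto
          finally show ?thesis by (simp add: dist_real_def mult.commute)
        qed
        then show ?thesis using \<open>0 \<le> M\<close> by (intro lipschitz_onI) auto
      qed
      have "closed S"
        using S tet_mesh_cell[OF T] by (auto simp: mesh_domain_def)
      then show "closed (\<phi> -` S)"
        by (rule closed_vimage) (auto simp: \<phi>_def intro!: continuous_intros)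
    next
      show "{0..1} \<subseteq> (\<Union>S\<in>insert (- mesh_domain \<T>) \<T>. \<phi> -` S)"
        using interior_subset[of "\<Union>\<T>"] by (auto simp: mesh_domain_def)
    qed (use \<open>0 \<le> M\<close> tet_mesh_finite[OF T] in auto)
    from lipschitz_onD[OF this, of 0 1] show ?thesis
      by (simp add: \<phi>_def M_def dist_norm norm_minus_commute)
  qed
  then have "L-lipschitz_on UNIV v" using \<open>0 \<le> L\<close> by (intro lipschitz_onI) auto
  then show thesis by (rule that)
qed

lemma mesh_grad_measurable:
  assumes T: "tet_mesh \<T>" and v: "v \<in> V_h0 \<T>"
  shows "mesh_grad \<T> v \<in> borel_measurable borel"
proof -
  obtain a b where cell: "\<forall>\<tau>\<in>\<T>. (\<forall>x\<in>\<tau>. v x = a \<tau> \<bullet> x + b \<tau>) \<and> (\<forall>x\<in>interior \<tau>. GDERIV v x :> a \<tau>)"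
    using V_h0_cellwise_affine[OF v] by blast
  then have a: "\<And>\<tau> x. \<tau> \<in> \<T> \<Longrightarrow> x \<in> interior \<tau> \<Longrightarrow> GDERIV v x :> a \<tau>"
    and ab: "\<And>\<tau> x. \<tau> \<in> \<T> \<Longrightarrow> x \<in> \<tau> \<Longrightarrow> v x = a \<tau> \<bullet> x + b \<tau>" by simp_all
  let ?N = "mesh_skeleton \<T>"
  let ?C = "{?N, - \<Union>\<T>} \<union> (\<lambda>\<tau>. interior \<tau> - ?N) ` \<T>"
  have Nb: "?N \<in> sets borel" using closed_mesh_skeleton[OF T] by simp
  show ?thesis
  proof (rule measurable_piecewise_restrict[of ?C])
    show "countable ?C" using tet_mesh_finite[OF T] by (intro countable_finite) simp
    have "x \<in> \<Union>?C" for x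
    proof (cases "x \<in> ?N")
      case False
      then show ?thesis by (cases rule: off_skeleton_cases) (use False in auto)
    qed simp
    then show "space borel \<subseteq> \<Union>?C" by blast
  next
    fix S assume S: "S \<in> ?C"
    then show "S \<inter> space borel \<in> sets borel" using Nb tet_mesh_Union[OF T] by auto
    consider "S = ?N" | "S = - \<Union>\<T>" | \<tau> where "\<tau> \<in> \<T>" "S = interior \<tau> - ?N"
      using S by auto
    then have "\<exists>k. \<forall>x\<in>S. mesh_grad \<T> v x = k"
    proof cases
      case 1 then show ?thesis by (auto simp: mesh_grad_def)
    next
      case 2 then show ?thesis using mesh_grad_outside[OF T v] by auto
    next
      case (3 \<tau>) then show ?thesis using a[OF 3(1)] by (intro exI[of _ "a \<tau>"]) (auto intro: mesh_grad_eqI)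
    qed
    then obtain k where "\<forall>x\<in>S. mesh_grad \<T> v x = k" by blast
    then show "mesh_grad \<T> v \<in> borel_measurable (restrict_space borel S)"
      by (subst measurable_cong[where g="\<lambda>_. k"]) (auto simp: space_restrict_space)
  qed
qed

lemma mesh_grad_bounded:
  assumes T: "tet_mesh \<T>" and v: "v \<in> V_h0 \<T>"
  obtains L where "0 \<le> L" "\<And>x. norm (mesh_grad \<T> v x) \<le> L"
proof -
  obtain a b where cell: "\<forall>\<tau>\<in>\<T>. (\<forall>x\<in>\<tau>. v x = a \<tau> \<bullet> x + b \<tau>) \<and> (\<forall>x\<in>interior \<tau>. GDERIV v x :> a \<tau>)"
    using V_h0_cellwise_affine[OF v] by blast
  then have a: "\<And>\<tau> x. \<tau> \<in> \<T> \<Longrightarrow> x \<in> interior \<tau> \<Longrightarrow> GDERIV v x :> a \<tau>"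
    and ab: "\<And>\<tau> x. \<tau> \<in> \<T> \<Longrightarrow> x \<in> \<tau> \<Longrightarrow> v x = a \<tau> \<bullet> x + b \<tau>" by simp_all
  define L where "L = (\<Sum>\<tau>\<in>\<T>. norm (a \<tau>))"
  have L: "norm (a \<tau>) \<le> L" if "\<tau> \<in> \<T>" for \<tau>
    unfolding L_def using tet_mesh_finite[OF T] that by (intro member_le_sum) auto
  have "0 \<le> L" by (simp add: L_def sum_nonneg)
  moreover have "norm (mesh_grad \<T> v x) \<le> L" for x
  proof (cases "x \<in> mesh_skeleton \<T>")
    case True then show ?thesis using \<open>0 \<le> L\<close> by (simp add: mesh_grad_def)
  next
    case False
    then show ?thesis
    proof (cases rule: off_skeleton_cases)
      case (inside \<tau>) then show ?thesis using mesh_grad_eqI[OF False a[OF inside]] L[OF inside(1)] by simp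
    next
      case outside then show ?thesis using mesh_grad_outside[OF T v] \<open>0 \<le> L\<close> by simp
    qed
  qed
  ultimately show thesis by (rule that)
qed

lemma mesh_grad_integrable:
  assumes T: "tet_mesh \<T>" and v: "v \<in> V_h0 \<T>" and w: "w \<in> V_h0 \<T>"
  shows "integrable lborel (\<lambda>x. mesh_grad \<T> v x \<bullet> mesh_grad \<T> w x)"
proof -
  obtain L where L: "0 \<le> L" "\<And>x. norm (mesh_grad \<T> v x) \<le> L" using mesh_grad_bounded[OF T v] by blast
  obtain M where M: "0 \<le> M" "\<And>x. norm (mesh_grad \<T> w x) \<le> M" using mesh_grad_bounded[OF T w] by blast
  have "emeasure lborel (\<Union>\<T>) < \<infinity>"
    by (rule emeasure_bounded_finite) (rule compact_imp_bounded[OF tet_mesh_Union(1)[OF T]])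
  moreover have "\<Union>\<T> \<in> sets lborel" using tet_mesh_Union(2)[OF T] by simp
  ultimately have "integrable lborel (\<lambda>x. L * M * indicat_real (\<Union>\<T>) x)"
    by (intro integrable_mult_right integrable_real_indicator)
  then show ?thesis
  proof (rule Bochner_Integration.integrable_bound)
    show "(\<lambda>x. mesh_grad \<T> v x \<bullet> mesh_grad \<T> w x) \<in> borel_measurable lborel"
      using borel_measurable_inner[OF mesh_grad_measurable[OF T v] mesh_grad_measurable[OF T w]] by simp
    have LM: "\<bar>mesh_grad \<T> v x \<bullet> mesh_grad \<T> w x\<bar> \<le> L * M" for x
      by (rule order_trans[OF Cauchy_Schwarz_ineq2]) (use L M in \<open>auto intro: mult_mono\<close>)
    have "norm (mesh_grad \<T> v x \<bullet> mesh_grad \<T> w x) \<le> norm (L * M * indicat_real (\<Union>\<T>) x)" for x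
    proof (cases "x \<in> \<Union>\<T>")
      case True then show ?thesis using LM[of x] L M by (simp add: abs_mult)
    qed (simp add: mesh_grad_outside[OF T v])
    then show "AE x in lborel. norm (mesh_grad \<T> v x \<bullet> mesh_grad \<T> w x)
                 \<le> norm (L * M * indicat_real (\<Union>\<T>) x)"
      by simp
  qed
qed

text \<open>The domain \<open>\<Omega>\<close> disappears because gradients vanish outside the mesh, up to the skeleton. The lemma also
trades Lebesgue measure for \<open>lborel\<close>, on which the dilation lemmas are stated.\<close>

lemma L2_inner_grad_eq:
  assumes T: "tet_mesh \<T>" and v: "v \<in> V_h0 \<T>" and w: "w \<in> V_h0 \<T>" and sub: "mesh_domain \<T> \<subseteq> \<Omega>"
  shows "L2_inner \<Omega> (grad v) (grad w) = (\<integral>x. mesh_grad \<T> v x \<bullet> mesh_grad \<T> w x \<partial>lborel)"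
proof -
  let ?f = "\<lambda>x. indicat_real \<Omega> x *\<^sub>R (grad v x \<bullet> grad w x)"
  let ?g = "\<lambda>x. mesh_grad \<T> v x \<bullet> mesh_grad \<T> w x"
  have g: "?g \<in> borel_measurable borel"
    by (intro borel_measurable_inner mesh_grad_measurable T v w)
  have "?f x = ?g x" if x: "x \<notin> mesh_skeleton \<T>" for x
    using x
  proof (cases rule: off_skeleton_cases)
    case (inside \<tau>)
    then have "x \<in> \<Omega>" using sub interior_cell_subset by blast
    then show ?thesis using x by (simp add: mesh_grad_def)
  next
    case outside
    then show ?thesis
      using mesh_grad_outside[OF T v outside] grad_eqI[OF V_h0_gderiv_outside[OF T v outside]] by simp
  qed
  then have ae: "AE x in lborel. ?f x = ?g x"
    by (intro eventually_mono[OF AE_not_in[OF null_mesh_skeleton[OF T]]]) simp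
  have "L2_inner \<Omega> (grad v) (grad w) = integral\<^sup>L lebesgue ?f"
    by (simp add: L2_inner_def set_lebesgue_integral_def)
  also have "\<dots> = integral\<^sup>L lebesgue ?g"
  proof (rule integral_cong_AE)
    show "?f \<in> borel_measurable lebesgue" by (rule measurable_lebesgue_AE_eq[OF g ae])
    show "?g \<in> borel_measurable lebesgue" by (rule measurable_completion) (use g in simp)
    show "AE x in lebesgue. ?f x = ?g x" by (rule AE_completion[OF ae])
  qed
  also have "\<dots> = integral\<^sup>L lborel ?g"
    using g by (intro integral_completion) simp
  finally show ?thesis .
qed

section \<open>Inverse estimate and discrete Sobolev inequality\<close>

text \<open>The joint content of size \<open>h\<close>, quasi-uniformity and shape regularity for a single mesh: every cell has
diameter at most \<open>h\<close> and contains a ball of radius comparable to \<open>h\<close>. All constants below depend on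
\<open>q\<close> only.\<close>

definition regular_mesh :: "real \<Rightarrow> real \<Rightarrow> R3 set set \<Rightarrow> bool" where
  "regular_mesh q h \<T> \<longleftrightarrow> tet_mesh \<T> \<and> 0 < q \<and> 0 < h \<and>
     (\<forall>\<tau>\<in>\<T>. diameter \<tau> \<le> h \<and> (\<exists>c. cball c (q * h) \<subseteq> \<tau>))"

definition energy :: "R3 set set \<Rightarrow> (R3 \<Rightarrow> real) \<Rightarrow> (R3 \<Rightarrow> real) \<Rightarrow> real" where
  "energy \<T> v w = (\<integral>x. mesh_grad \<T> v x \<bullet> mesh_grad \<T> w x \<partial>lborel)"

definition inverse_const :: "real \<Rightarrow> real" where
  "inverse_const q = 1 / sqrt (measure lborel (ball (0::R3) 1) * q ^ 3)"

definition sobolev_const :: "real \<Rightarrow> real" where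
  "sobolev_const q = (1 + measure lborel (ball (0::R3) 1)) / (measure lborel (ball (0::R3) 1) * sqrt q)
     + inverse_const q"

lemma unit_ball_pos: "0 < measure lborel (ball (0::R3) 1)"
  by (simp add: content_ball_pos)

lemma inverse_const_pos: "0 < q \<Longrightarrow> 0 < inverse_const q"
  using unit_ball_pos by (simp add: inverse_const_def)

lemma sobolev_const_pos: "0 < q \<Longrightarrow> 0 < sobolev_const q"
  using unit_ball_pos inverse_const_pos[of q] by (simp add: sobolev_const_def add_pos_pos)

lemma measure_ball_scale: "0 \<le> r \<Longrightarrow> measure lborel (ball (c::R3) r) = measure lborel (ball (0::R3) 1) * r ^ 3"
  by (simp add: content_ball)

text \<open>The linear part is odd about the center and integrates to zero.\<close>

lemma ball_average_affine:
  fixes v :: "R3 \<Rightarrow> real"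
  assumes "\<And>x. x \<in> cball c r \<Longrightarrow> v x = a \<bullet> x + b" "0 < r"
  shows "(\<integral>w. indicat_real (ball 0 1) w * v (c + r *\<^sub>R w) \<partial>lborel) = measure lborel (ball (0::R3) 1) * v c"
proof -
  let ?B = "ball (0::R3) 1"
  have iB: "integrable lborel (indicat_real ?B)"
    by (intro integrable_real_indicator emeasure_lborel_ball_finite) auto
  have [measurable]: "?B \<in> sets borel" by simp
  have m: "(\<lambda>w. indicat_real ?B w * (a \<bullet> w)) \<in> borel_measurable lborel"
    by simp
  have i: "integrable lborel (\<lambda>w. indicat_real ?B w * (a \<bullet> w))"
  proof (rule Bochner_Integration.integrable_bound[OF _ m])
    show "integrable lborel (\<lambda>w. norm a * indicat_real ?B w)" using iB by simp
    have "\<bar>a \<bullet> w\<bar> \<le> norm a" if "norm w < 1" for w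
    proof -
      have "\<bar>a \<bullet> w\<bar> \<le> norm a * norm w" by (rule Cauchy_Schwarz_ineq2)
      also have "\<dots> \<le> norm a" using that by (intro mult_left_le) auto
      finally show ?thesis .
    qed
    then show "AE w in lborel. norm (indicat_real ?B w * (a \<bullet> w)) \<le> norm (norm a * indicat_real ?B w)"
      by (intro AE_I2) (simp add: indicator_def)
  qed
  have odd: "(\<integral>w. indicat_real ?B w * (a \<bullet> w) \<partial>lborel) = 0"
  proof -
    have "(\<integral>w. indicat_real ?B (0 + (-1) *\<^sub>R w) * (a \<bullet> (0 + (-1) *\<^sub>R w)) \<partial>lborel)
          = (\<integral>w. indicat_real ?B w * (a \<bullet> w) \<partial>lborel) / \<bar>-1\<bar> ^ DIM(R3)"
      by (rule integral_dilation_lborel(1)) (use i in auto)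
    moreover have "(\<integral>w. indicat_real ?B (0 + (-1) *\<^sub>R w) * (a \<bullet> (0 + (-1) *\<^sub>R w)) \<partial>lborel)
          = (\<integral>w. - (indicat_real ?B w * (a \<bullet> w)) \<partial>lborel)"
      by (intro Bochner_Integration.integral_cong) (auto simp: indicator_def)
    ultimately show ?thesis by simp
  qed
  have "indicat_real ?B w * v (c + r *\<^sub>R w) = v c * indicat_real ?B w + r * (indicat_real ?B w * (a \<bullet> w))" for w
  proof (cases "w \<in> ?B")
    case True
    then have "c + r *\<^sub>R w \<in> cball c r" using \<open>0 < r\<close> by (simp add: dist_norm mult_left_le)
    then show ?thesis using True assms by (simp add: inner_add_right indicator_def)
  qed simp
  then have "(\<integral>w. indicat_real ?B w * v (c + r *\<^sub>R w) \<partial>lborel)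
      = (\<integral>w. v c * indicat_real ?B w + r * (indicat_real ?B w * (a \<bullet> w)) \<partial>lborel)" by simp
  also have "\<dots> = (\<integral>w. v c * indicat_real ?B w \<partial>lborel) + (\<integral>w. r * (indicat_real ?B w * (a \<bullet> w)) \<partial>lborel)"
    by (rule Bochner_Integration.integral_add) (use iB i in auto)
  also have "\<dots> = measure lborel ?B * v c" using odd by simp
  finally show ?thesis .
qed

text \<open>The gradient is constant on the inscribed ball, so its squared length times the volume of that ball is
part of the energy.\<close>

lemma cell_slope_bound:
  assumes T: "tet_mesh \<T>" and v: "v \<in> V_h0 \<T>" and \<tau>: "\<tau> \<in> \<T>" "cball c r \<subseteq> \<tau>" "0 < r"
    and a: "\<And>x. x \<in> interior \<tau> \<Longrightarrow> GDERIV v x :> a" and S: "energy \<T> v v \<le> S\<^sup>2" "0 \<le> S"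
  shows "norm a \<le> S / sqrt (measure lborel (ball (0::R3) 1) * r ^ 3)"
proof -
  let ?m = "measure lborel (ball (0::R3) 1) * r ^ 3"
  have m: "?m > 0" using unit_ball_pos \<tau> by simp
  have sub: "ball c r \<subseteq> interior \<tau>"
    using \<tau>(2) by (intro interior_maximal) (auto intro: ball_subset_cball[THEN subsetD])
  have i: "integrable lborel (indicat_real (ball c r))"
    by (intro integrable_real_indicator emeasure_lborel_ball_finite) auto
  have "(norm a)\<^sup>2 * ?m = (\<integral>x. (norm a)\<^sup>2 * indicat_real (ball c r) x \<partial>lborel)"
    using \<tau>(3) measure_ball_scale[of r c] by simp
  also have "\<dots> \<le> energy \<T> v v"
    unfolding energy_def
  proof (rule integral_mono_AE)
    show "integrable lborel (\<lambda>x. (norm a)\<^sup>2 * indicat_real (ball c r) x)" using i by simp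
    show "integrable lborel (\<lambda>x. mesh_grad \<T> v x \<bullet> mesh_grad \<T> v x)"
      by (rule mesh_grad_integrable[OF T v v])
    have "(norm a)\<^sup>2 * indicat_real (ball c r) x \<le> mesh_grad \<T> v x \<bullet> mesh_grad \<T> v x"
      if "x \<notin> mesh_skeleton \<T>" for x
    proof (cases "x \<in> ball c r")
      case True
      then have "mesh_grad \<T> v x = a" using that sub a by (intro mesh_grad_eqI) auto
      then show ?thesis by (simp add: power2_norm_eq_inner indicator_def)
    qed simp
    then show "AE x in lborel. (norm a)\<^sup>2 * indicat_real (ball c r) x \<le> mesh_grad \<T> v x \<bullet> mesh_grad \<T> v x"
      by (intro eventually_mono[OF AE_not_in[OF null_mesh_skeleton[OF T]]]) simp
  qed
  also have "\<dots> \<le> S\<^sup>2" by (rule S)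
  finally have "(norm a * sqrt ?m)\<^sup>2 \<le> S\<^sup>2" using m by (simp add: power_mult_distrib)
  then have "norm a * sqrt ?m \<le> S" using S(2) by (rule power2_le_imp_le)
  then show ?thesis using m by (simp add: pos_le_divide_eq)
qed

lemma inverse_const_scale:
  "0 < h \<Longrightarrow> 0 < q \<Longrightarrow> S / sqrt (measure lborel (ball (0::R3) 1) * (q * h) ^ 3) = inverse_const q * S / sqrt h ^ 3"
  by (simp add: inverse_const_def real_sqrt_mult real_sqrt_power power_mult_distrib)

lemma inverse_estimate:
  assumes M: "regular_mesh q h \<T>" and v: "v \<in> V_h0 \<T>" and S: "energy \<T> v v \<le> S\<^sup>2" "0 \<le> S"
  shows "norm (mesh_grad \<T> v x) \<le> inverse_const q * S / sqrt h ^ 3"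
proof -
  have T: "tet_mesh \<T>" and q: "0 < q" and h: "0 < h" using M by (auto simp: regular_mesh_def)
  have nonneg: "0 \<le> inverse_const q * S / sqrt h ^ 3"
    using inverse_const_pos[OF q] S h by simp
  show ?thesis
  proof (cases "x \<in> mesh_skeleton \<T>")
    case True then show ?thesis using nonneg by (simp add: mesh_grad_def)
  next
    case False
    then show ?thesis
    proof (cases rule: off_skeleton_cases)
      case outside then show ?thesis using mesh_grad_outside[OF T v] nonneg by simp
    next
      case (inside \<tau>)
      obtain c where c: "cball c (q * h) \<subseteq> \<tau>" using M inside by (auto simp: regular_mesh_def)
      obtain a where a: "\<forall>x\<in>interior \<tau>. GDERIV v x :> a"
        using V_h0_cellwise_affine[OF v] inside by blast
      have "norm a \<le> S / sqrt (measure lborel (ball (0::R3) 1) * (q * h) ^ 3)"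
        by (rule cell_slope_bound[OF T v inside(1) c _ _ S]) (use a q h in auto)
      moreover have "mesh_grad \<T> v x = a" using a inside False by (intro mesh_grad_eqI) auto
      ultimately show ?thesis using inverse_const_scale[OF h q] by simp
    qed
  qed
qed

text \<open>The value at the center \<open>c\<close> of a ball inscribed in the cell of \<open>z\<close> is an average of \<open>v\<close>, which
\<open>ball_average_le\<close> bounds; the distance from \<open>c\<close> to \<open>z\<close> costs at most \<open>h\<close> times the slope. Both
contributions scale as \<open>h\<^bsup>-1/2\<^esup>\<close>. The bound \<open>S\<close> on the norm is required to be positive, but not to be
attained, so that functions of zero energy are covered by letting \<open>S\<close> tend to zero.\<close>

lemma discrete_sobolev:
  assumes M: "regular_mesh q h \<T>" and v: "v \<in> V_h0 \<T>" and S: "energy \<T> v v \<le> S\<^sup>2" "0 < S"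
  shows "\<bar>v z\<bar> \<le> sobolev_const q * S / sqrt h"
proof (cases "z \<in> mesh_domain \<T>")
  case False
  moreover have "0 < h" "0 < q" using M by (auto simp: regular_mesh_def)
  ultimately show ?thesis using sobolev_const_pos[of q] S V_h0_outside[OF v] by simp
next
  case True
  have T: "tet_mesh \<T>" and q: "0 < q" and h: "0 < h" using M by (auto simp: regular_mesh_def)
  obtain \<tau> where \<tau>: "\<tau> \<in> \<T>" "z \<in> \<tau>"
    using True interior_subset by (fastforce simp: mesh_domain_def)
  obtain c where c: "cball c (q * h) \<subseteq> \<tau>" and diam: "diameter \<tau> \<le> h"
    using M \<tau> by (auto simp: regular_mesh_def)
  obtain a b where ab: "\<forall>x\<in>\<tau>. v x = a \<bullet> x + b" and a: "\<forall>x\<in>interior \<tau>. GDERIV v x :> a"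
    using V_h0_cellwise_affine[OF v] \<tau>(1) by blast
  let ?\<beta> = "measure lborel (ball (0::R3) 1)"
  have c_in: "c \<in> \<tau>" using c q h by auto
  obtain L where L: "L-lipschitz_on UNIV v" using V_h0_lipschitz[OF T v] by blast
  obtain R where R: "\<Union>\<T> \<subseteq> cball 0 R"
    using bounded_subset_ballD[OF compact_imp_bounded[OF tet_mesh_Union(1)[OF T]], of 0] ball_subset_cball by blast
  have "\<bar>\<integral>w. indicat_real (ball 0 1) w * v (c + (q * h) *\<^sub>R w) \<partial>lborel\<bar>
           \<le> (1 + ?\<beta>) * S / sqrt (q * h)"
  proof (rule ball_average_le[OF L _ null_mesh_skeleton[OF T] mesh_grad_measurable[OF T v]])
    show "v x = 0" if "x \<notin> cball 0 R" for x
      using that R interior_subset[of "\<Union>\<T>"] unfolding mesh_domain_def[symmetric]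
      by (intro V_h0_outside[OF v]) blast
    show "GDERIV v x :> mesh_grad \<T> v x" if "x \<notin> mesh_skeleton \<T>" for x
      by (rule V_h0_gderiv[OF T v that])
    show "integrable lborel (\<lambda>x. (norm (mesh_grad \<T> v x))\<^sup>2)"
      using mesh_grad_integrable[OF T v v] by (simp add: power2_norm_eq_inner)
    show "(\<integral>x. (norm (mesh_grad \<T> v x))\<^sup>2 \<partial>lborel) \<le> S\<^sup>2"
      using S(1) by (simp add: energy_def power2_norm_eq_inner)
  qed (use S q h in auto)
  moreover have "(\<integral>w. indicat_real (ball 0 1) w * v (c + (q * h) *\<^sub>R w) \<partial>lborel) = ?\<beta> * v c"
    by (rule ball_average_affine) (use ab c q h in auto)
  ultimately have "?\<beta> * \<bar>v c\<bar> \<le> (1 + ?\<beta>) * S / sqrt (q * h)"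
    by (simp add: abs_mult)
  then have vc: "\<bar>v c\<bar> \<le> (1 + ?\<beta>) / (?\<beta> * sqrt q) * S / sqrt h"
    using unit_ball_pos q h by (simp add: field_simps real_sqrt_mult)
  have "norm a \<le> S / sqrt (?\<beta> * (q * h) ^ 3)"
    by (rule cell_slope_bound[OF T v \<tau>(1) c _ _ S(1)]) (use a q h S in auto)
  then have na: "norm a \<le> inverse_const q * S / sqrt h ^ 3"
    using inverse_const_scale[OF h q] by simp
  have "dist z c \<le> h"
    using diameter_bounded_bound[OF tet_mesh_cell(4)[OF T \<tau>(1)] \<tau>(2) c_in] diam by simp
  have "\<bar>v z - v c\<bar> = \<bar>a \<bullet> (z - c)\<bar>"
    using ab \<tau>(2) c_in by (simp add: inner_diff_right)
  also have "\<dots> \<le> norm a * norm (z - c)" by (rule Cauchy_Schwarz_ineq2)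
  also have "\<dots> \<le> inverse_const q * S / sqrt h ^ 3 * h"
    using na \<open>dist z c \<le> h\<close> by (intro mult_mono) (auto simp: dist_norm intro: order_trans[OF norm_ge_zero na])
  also have "\<dots> = inverse_const q * S / sqrt h"
  proof -
    have "sqrt h ^ 3 = h * sqrt h" using h by (simp add: power3_eq_cube)
    then show ?thesis using h by simp
  qed
  finally have "\<bar>v z\<bar> \<le> (1 + ?\<beta>) / (?\<beta> * sqrt q) * S / sqrt h + inverse_const q * S / sqrt h"
    using vc by linarith
  then show ?thesis by (simp add: sobolev_const_def distrib_right add_divide_distrib)
qed

text \<open>For zero energy the discrete Sobolev inequality holds with every \<open>S > 0\<close>.\<close>

lemma energy_definite:
  assumes M: "regular_mesh q h \<T>" and v: "v \<in> V_h0 \<T>" and "energy \<T> v v = 0"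
  shows "v = (\<lambda>_. 0)"
proof
  fix z
  have h: "0 < h" and C: "0 < sobolev_const q" using M by (auto simp: regular_mesh_def sobolev_const_pos)
  show "v z = 0"
  proof (rule ccontr)
    assume "v z \<noteq> 0"
    (* chosen so that the discrete Sobolev bound equals half of the value it bounds *)
    define S where "S = \<bar>v z\<bar> * sqrt h / (2 * sobolev_const q)"
    have "S > 0" using \<open>v z \<noteq> 0\<close> h C by (simp add: S_def)
    then have "\<bar>v z\<bar> \<le> sobolev_const q * S / sqrt h"
      using discrete_sobolev[OF M v _ \<open>S > 0\<close>] assms(3) by simp
    also have "\<dots> = \<bar>v z\<bar> / 2" using h C by (simp add: S_def)
    finally show False using \<open>v z \<noteq> 0\<close> by simp
  qed
qed

section \<open>The discrete Green's function\<close>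

lemma V_h0_zero: "(\<lambda>_. 0) \<in> V_h0 \<T>"
  unfolding V_h0_def V_h_def by (auto intro!: exI[of _ 0])

lemma V_h0_add:
  assumes "u \<in> V_h0 \<T>" "v \<in> V_h0 \<T>" shows "(\<lambda>x. u x + v x) \<in> V_h0 \<T>"
proof -
  have "\<exists>a b. \<forall>x\<in>\<tau>. u x + v x = a \<bullet> x + b" if "\<tau> \<in> \<T>" for \<tau>
  proof -
    obtain a b where "\<forall>x\<in>\<tau>. u x = a \<bullet> x + b" using V_h0_affine_on_cell[OF assms(1) \<open>\<tau> \<in> \<T>\<close>] by blast
    moreover obtain a' b' where "\<forall>x\<in>\<tau>. v x = a' \<bullet> x + b'" using V_h0_affine_on_cell[OF assms(2) \<open>\<tau> \<in> \<T>\<close>] by blast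
    ultimately show ?thesis
      by (intro exI[of _ "a + a'"] exI[of _ "b + b'"]) (simp add: inner_add_left)
  qed
  then show ?thesis
    using assms by (simp add: V_h0_def V_h_def continuous_on_add)
qed

lemma V_h0_scale:
  assumes "u \<in> V_h0 \<T>" shows "(\<lambda>x. r * u x) \<in> V_h0 \<T>"
proof -
  have "\<exists>a b. \<forall>x\<in>\<tau>. r * u x = a \<bullet> x + b" if "\<tau> \<in> \<T>" for \<tau>
  proof -
    obtain a b where "\<forall>x\<in>\<tau>. u x = a \<bullet> x + b" using V_h0_affine_on_cell[OF assms(1) \<open>\<tau> \<in> \<T>\<close>] by blast
    then show ?thesis
      by (intro exI[of _ "r *\<^sub>R a"] exI[of _ "r * b"]) (simp add: distrib_left)
  qed
  then show ?thesis
    using assms by (simp add: V_h0_def V_h_def continuous_on_mult_left)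
qed

lemma mesh_grad_add:
  assumes T: "tet_mesh \<T>" and u: "u \<in> V_h0 \<T>" and v: "v \<in> V_h0 \<T>"
  shows "mesh_grad \<T> (\<lambda>x. u x + v x) x = mesh_grad \<T> u x + mesh_grad \<T> v x"
proof (cases "x \<in> mesh_skeleton \<T>")
  case False
  then show ?thesis by (intro mesh_grad_eqI GDERIV_add V_h0_gderiv T u v)
qed (simp add: mesh_grad_def)

lemma mesh_grad_scale:
  assumes T: "tet_mesh \<T>" and u: "u \<in> V_h0 \<T>"
  shows "mesh_grad \<T> (\<lambda>x. r * u x) x = r *\<^sub>R mesh_grad \<T> u x"
proof (cases "x \<in> mesh_skeleton \<T>")
  case False
  have "GDERIV (\<lambda>x. r * u x) x :> r *\<^sub>R mesh_grad \<T> u x + u x *\<^sub>R 0"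
    by (intro GDERIV_mult GDERIV_const V_h0_gderiv T u False)
  then show ?thesis using False by (intro mesh_grad_eqI) auto
qed (simp add: mesh_grad_def)

lemma energy_add:
  assumes T: "tet_mesh \<T>" and "u \<in> V_h0 \<T>" "v \<in> V_h0 \<T>" "w \<in> V_h0 \<T>"
  shows "energy \<T> (\<lambda>x. u x + v x) w = energy \<T> u w + energy \<T> v w"
  using assms by (simp add: energy_def mesh_grad_add inner_add_left mesh_grad_integrable)

lemma energy_scale:
  assumes T: "tet_mesh \<T>" and "u \<in> V_h0 \<T>"
  shows "energy \<T> (\<lambda>x. r * u x) w = r * energy \<T> u w"
  using assms by (simp add: energy_def mesh_grad_scale)

lemma energy_commute: "energy \<T> u v = energy \<T> v u"
  by (simp add: energy_def inner_commute)

text \<open>Each cell is the convex hull of its vertices, and the zero set of an affine function is convex.\<close>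

lemma V_h0_determined_by_vertices:
  assumes T: "tet_mesh \<T>"
  shows "\<exists>N. finite N \<and> (\<forall>v\<in>V_h0 \<T>. (\<forall>x\<in>N. v x = 0) \<longrightarrow> v = (\<lambda>_. 0))"
proof -
  have "\<forall>\<tau>\<in>\<T>. \<exists>C. finite C \<and> \<tau> = convex hull C"
    using T unfolding tet_mesh_def simplex by metis
  then obtain C where C: "\<forall>\<tau>\<in>\<T>. finite (C \<tau>) \<and> \<tau> = convex hull (C \<tau>)" by metis
  have "v = (\<lambda>_. 0)" if v: "v \<in> V_h0 \<T>" and 0: "\<forall>x\<in>(\<Union>\<tau>\<in>\<T>. C \<tau>). v x = 0" for v
  proof
    fix x
    show "v x = 0"
    proof (cases "x \<in> mesh_domain \<T>")
      case True
      then obtain \<tau> where \<tau>: "\<tau> \<in> \<T>" "x \<in> \<tau>"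
        using interior_subset by (fastforce simp: mesh_domain_def)
      obtain a b where ab: "\<forall>y\<in>\<tau>. v y = a \<bullet> y + b" using V_h0_affine_on_cell[OF v \<tau>(1)] by blast
      have "convex hull (C \<tau>) \<subseteq> {y. a \<bullet> y = - b}"
      proof (rule hull_minimal)
        show "C \<tau> \<subseteq> {y. a \<bullet> y = - b}"
        proof
          fix y assume y: "y \<in> C \<tau>"
          then have "y \<in> \<tau>" using C \<tau>(1) hull_inc by metis
          then have "a \<bullet> y + b = 0" using ab 0 y \<tau>(1) by force
          then show "y \<in> {y. a \<bullet> y = - b}" by (simp add: eq_neg_iff_add_eq_0)
        qed
      qed (rule convex_hyperplane)
      then have "a \<bullet> x = - b" using C \<tau> by blast
      then show ?thesis using ab \<tau> by simp
    qed (rule V_h0_outside[OF v])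
  qed
  moreover have "finite (\<Union>\<tau>\<in>\<T>. C \<tau>)" using C tet_mesh_finite[OF T] by auto
  ultimately show ?thesis by blast
qed

lemma discrete_green_exists:
  assumes M: "regular_mesh q h \<T>"
  shows "\<exists>G\<in>V_h0 \<T>. \<forall>v\<in>V_h0 \<T>. energy \<T> G v = v z"
proof -
  have T: "tet_mesh \<T>" using M by (simp add: regular_mesh_def)
  obtain N where N: "finite N" "\<And>v. v \<in> V_h0 \<T> \<Longrightarrow> \<forall>x\<in>N. v x = 0 \<Longrightarrow> v = (\<lambda>_. 0)"
    using V_h0_determined_by_vertices[OF T] by blast
  show ?thesis
  proof (rule riesz_finitely_many_values)
    show "v = (\<lambda>_. 0)" if "v \<in> V_h0 \<T>" "\<forall>x\<in>N. v x = 0" for v by (rule N(2)[OF that])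
    show "energy \<T> u v = energy \<T> v u" for u v by (rule energy_commute)
    show "energy \<T> (\<lambda>x. u x + v x) w = energy \<T> u w + energy \<T> v w"
      if "u \<in> V_h0 \<T>" "v \<in> V_h0 \<T>" "w \<in> V_h0 \<T>" for u v w
      by (rule energy_add[OF T that])
    show "energy \<T> (\<lambda>x. r * u x) w = r * energy \<T> u w" if "u \<in> V_h0 \<T>" for r u w
      by (rule energy_scale[OF T that])
    show "v = (\<lambda>_. 0)" if "v \<in> V_h0 \<T>" "energy \<T> v v = 0" for v
      by (rule energy_definite[OF M that])
  qed (simp_all add: N(1) V_h0_zero V_h0_add V_h0_scale)
qed

lemma discrete_green_spec:
  assumes M: "regular_mesh q h \<T>" and sub: "mesh_domain \<T> \<subseteq> \<Omega>"
  shows "discrete_green \<Omega> \<T> z \<in> V_h0 \<T>"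
    and "v \<in> V_h0 \<T> \<Longrightarrow> energy \<T> (discrete_green \<Omega> \<T> z) v = v z"
proof -
  have T: "tet_mesh \<T>" using M by (simp add: regular_mesh_def)
  let ?P = "\<lambda>G. G \<in> V_h0 \<T> \<and> (\<forall>v\<in>V_h0 \<T>. L2_inner \<Omega> (grad G) (grad v) = v z)"
  have eq: "L2_inner \<Omega> (grad u) (grad v) = energy \<T> u v" if "u \<in> V_h0 \<T>" "v \<in> V_h0 \<T>" for u v
    using L2_inner_grad_eq[OF T that sub] by (simp add: energy_def)
  obtain G where G: "G \<in> V_h0 \<T>" "\<forall>v\<in>V_h0 \<T>. energy \<T> G v = v z"
    using discrete_green_exists[OF M] by blast
  have "?P (THE G. ?P G)"
  proof (rule theI[of ?P G])
    show "?P G" using G eq by simp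
    fix H assume H: "?P H"
    define d where "d = (\<lambda>x. H x + (-1) * G x)"
    have d: "d \<in> V_h0 \<T>" unfolding d_def using H G by (intro V_h0_add V_h0_scale) auto
    have "energy \<T> d d = energy \<T> H d + (-1) * energy \<T> G d"
      using energy_add[OF T _ V_h0_scale[OF G(1)] d] energy_scale[OF T G(1)] H d_def by metis
    also have "energy \<T> H d = d z" using H d eq[of H d] by simp
    also have "energy \<T> G d = d z" using G(2) d by simp
    finally have "energy \<T> d d = 0" by simp
    then have "d = (\<lambda>_. 0)" by (rule energy_definite[OF M d])
    then show "H = G" unfolding d_def by (auto simp: fun_eq_iff)
  qed
  then have "?P (discrete_green \<Omega> \<T> z)" by (simp add: discrete_green_def)
  then show "discrete_green \<Omega> \<T> z \<in> V_h0 \<T>"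
    and "v \<in> V_h0 \<T> \<Longrightarrow> energy \<T> (discrete_green \<Omega> \<T> z) v = v z"
    using eq by auto
qed

text \<open>Testing with the Green's function itself turns its energy \<open>E\<close> into a point value, which the discrete
Sobolev inequality bounds by \<open>C sqrt E\<close>; dividing by \<open>sqrt E\<close> gives the claim.\<close>

lemma discrete_green_energy_bound:
  assumes M: "regular_mesh q h \<T>" and sub: "mesh_domain \<T> \<subseteq> \<Omega>"
  shows "energy \<T> (discrete_green \<Omega> \<T> z) (discrete_green \<Omega> \<T> z) \<le> (sobolev_const q / sqrt h)\<^sup>2"
proof -
  let ?G = "discrete_green \<Omega> \<T> z" and ?C = "sobolev_const q / sqrt h"
  note G = discrete_green_spec[OF M sub, where z=z]
  have C: "0 < ?C" using M by (simp add: regular_mesh_def sobolev_const_pos)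
  define E where "E = energy \<T> ?G ?G"
  have "0 \<le> E" by (simp add: E_def energy_def)
  show ?thesis
  proof (cases "E = 0")
    case False
    then have pos: "sqrt E > 0" using \<open>0 \<le> E\<close> by simp
    have "E = ?G z" using G by (simp add: E_def)
    also have "\<dots> \<le> ?C * sqrt E"
      using discrete_sobolev[OF M G(1) _ pos, where z=z] \<open>0 \<le> E\<close> by (simp add: E_def)
    finally have "sqrt E * sqrt E \<le> ?C * sqrt E" using \<open>0 \<le> E\<close> by simp
    then have "sqrt E \<le> ?C" using pos by (rule mult_right_le_imp_le)
    then have "(sqrt E)\<^sup>2 \<le> ?C\<^sup>2" using pos by (intro power_mono) auto
    then show ?thesis using \<open>0 \<le> E\<close> by (simp add: E_def)
  qed (use C in \<open>simp add: E_def\<close>)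
qed

section \<open>Interpolation between the energy norm and the maximum norm\<close>

text \<open>For finite \<open>p\<close> this is \<open>\<bar>f\<bar>\<^sup>p \<le> M\<^bsup>p-2\<^esup> \<bar>f\<bar>\<^sup>2\<close>, integrated. For \<open>p = \<infinity>\<close> the exponent \<open>2 / p\<close>
evaluates to \<open>0\<close>, and the bound becomes \<open>M\<close>. The measurability of \<open>F\<close> required by the essential
supremum comes from its Borel measurable version \<open>f\<close>.\<close>

lemma Lp_norm_interpolation:
  fixes F f :: "R3 \<Rightarrow> R3"
  assumes D: "D \<in> sets lebesgue" and f: "f \<in> borel_measurable borel"
    and ae: "AE x in lborel. F x = f x"
    and M: "\<And>x. norm (f x) \<le> M" "0 < M"
    and int: "integrable lborel (\<lambda>x. f x \<bullet> f x)" and S: "(\<integral>x. f x \<bullet> f x \<partial>lborel) \<le> S\<^sup>2" "0 < S"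
    and p: "2 \<le> p"
  shows "Lp_norm p D F \<le> ennreal (M powr (1 - enn2real (2 / p)) * S powr enn2real (2 / p))"
proof (cases "p = \<infinity>")
  case True
  have F: "F \<in> borel_measurable lebesgue" by (rule measurable_lebesgue_AE_eq[OF f ae])
  have "AE x in lebesgue. ennreal (norm (F x)) \<le> ennreal M"
    by (rule eventually_mono[OF AE_completion[OF ae]]) (simp add: M ennreal_leI)
  then have "AE x in lebesgue_on D. ennreal (norm (F x)) \<le> ennreal M"
    using D by (subst AE_restrict_space_iff) (auto elim: eventually_mono)
  moreover have "(\<lambda>x. ennreal (norm (F x))) \<in> borel_measurable (lebesgue_on D)"
    using F by (intro measurable_restrict_space1) simp
  ultimately have "esssup (lebesgue_on D) (\<lambda>x. ennreal (norm (F x))) \<le> ennreal M"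
    by (intro esssup_I)
  then show ?thesis using True M S by (simp add: Lp_norm_def)
next
  case False
  then obtain P where pP: "p = ennreal P" "0 \<le> P" by (cases p) auto
  then have P_eq: "enn2real p = P" by simp
  have P: "2 \<le> P"
    using p pP by (metis ennreal_le_iff ennreal_numeral)
  have "2 / p = ennreal (2 / P)" using divide_ennreal[of 2 P] P pP by simp
  then have \<theta>: "enn2real (2 / p) = 2 / P" using P by simp
  define I where "I = (\<integral>\<^sup>+ x. ennreal (norm (F x) powr P) \<partial>lebesgue_on D)"
  have pw: "norm (f x) powr P \<le> M powr (P - 2) * (f x \<bullet> f x)" for x
  proof (cases "f x = 0")
    case False
    have "norm (f x) powr P = norm (f x) powr (P - 2) * norm (f x) powr 2"
      using powr_add[of "norm (f x)" "P - 2" 2] by (simp del: powr_numeral)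
    also have "norm (f x) powr 2 = f x \<bullet> f x"
      using False by (simp add: powr_numeral power2_norm_eq_inner)
    also have "norm (f x) powr (P - 2) * (f x \<bullet> f x) \<le> M powr (P - 2) * (f x \<bullet> f x)"
      using M P by (intro mult_right_mono powr_mono2) auto
    finally show ?thesis .
  qed (use P in simp)
  have "I = (\<integral>\<^sup>+ x. ennreal (norm (F x) powr P) * indicator D x \<partial>lebesgue)"
    unfolding I_def using D by (subst nn_integral_restrict_space) auto
  also have "\<dots> \<le> (\<integral>\<^sup>+ x. ennreal (M powr (P - 2) * (f x \<bullet> f x)) \<partial>lebesgue)"
  proof (rule nn_integral_mono_AE)
    show "AE x in lebesgue. ennreal (norm (F x) powr P) * indicator D x \<le> ennreal (M powr (P - 2) * (f x \<bullet> f x))"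
      by (rule eventually_mono[OF AE_completion[OF ae]]) (auto simp: indicator_def pw intro!: ennreal_leI)
  qed
  also have "\<dots> = (\<integral>\<^sup>+ x. ennreal (M powr (P - 2) * (f x \<bullet> f x)) \<partial>lborel)"
    by (rule nn_integral_completion)
  also have "\<dots> = ennreal (\<integral>x. M powr (P - 2) * (f x \<bullet> f x) \<partial>lborel)"
    by (rule nn_integral_eq_integral) (use int in auto)
  also have "\<dots> \<le> ennreal (M powr (P - 2) * S\<^sup>2)"
    using S(1) by (intro ennreal_leI) (simp add: mult_left_mono)
  finally have I: "I \<le> ennreal (M powr (P - 2) * S\<^sup>2)" .
  then have "I \<noteq> \<infinity>" by (metis ennreal_less_top infinity_ennreal_def leD)
  have "enn2real I \<le> M powr (P - 2) * S\<^sup>2"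
    using enn2real_mono[OF I] by simp
  then have "enn2real I powr (1 / P) \<le> (M powr (P - 2) * S\<^sup>2) powr (1 / P)"
    using P by (intro powr_mono2) auto
  also have "\<dots> = M powr ((P - 2) / P) * S powr (2 / P)"
    using M S by (simp add: powr_mult powr_powr powr_numeral[symmetric] del: powr_numeral)
  also have "(P - 2) / P = 1 - 2 / P" using P by (simp add: diff_divide_distrib)
  finally have "enn2real I powr (1 / P) \<le> M powr (1 - 2 / P) * S powr (2 / P)" .
  then show ?thesis
    using False \<open>I \<noteq> \<infinity>\<close> by (simp add: Lp_norm_def Let_def P_eq I_def[symmetric] \<theta> ennreal_leI)
qed

text \<open>With \<open>\<theta> = 2 / p\<close> and \<open>b / sqrt h\<close> the energy bound, the inverse estimate gives the maximum norm
bound \<open>a b h\<^bsup>-2\<^esup>\<close>; the exponents combine to \<open>-2 (1 - \<theta>) - \<theta> / 2 = 3 / p - 2\<close>.\<close>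

lemma interpolated_power:
  assumes h: "0 < h" and "0 < a" "0 < b" and \<theta>: "0 \<le> \<theta>" "\<theta> \<le> 1"
  shows "(a * (b / sqrt h) / sqrt h ^ 3) powr (1 - \<theta>) * (b / sqrt h) powr \<theta>
           \<le> (1 + a) * b * h powr (3 / 2 * \<theta> - 2)"
proof -
  have "a powr (1 - \<theta>) \<le> 1 + a"
  proof -
    have "a powr (1 - \<theta>) \<le> (1 + a) powr (1 - \<theta>)"
      using assms by (intro powr_mono2) auto
    also have "\<dots> \<le> (1 + a) powr 1"
      using assms by (intro powr_mono) auto
    finally show ?thesis using assms by simp
  qed
  have sq: "sqrt h = h powr (1/2)" using h by (simp add: powr_half_sqrt)
  have S_eq: "b / sqrt h = b * h powr (-(1/2))"
    by (simp only: sq powr_minus_divide times_divide_eq_right mult_1_right)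
  have "a * (b / sqrt h) / sqrt h ^ 3 = a * b / h powr 2"
    using h by (simp add: eval_nat_numeral powr_numeral)
  then have M_eq: "a * (b / sqrt h) / sqrt h ^ 3 = a * b * h powr (-2)"
    by (simp only: powr_minus_divide times_divide_eq_right mult_1_right)
  have M_pow: "(a * b * h powr (-2)) powr (1 - \<theta>)
      = a powr (1 - \<theta>) * b powr (1 - \<theta>) * h powr (-2 * (1 - \<theta>))"
    using assms by (simp only: powr_mult powr_powr)
  have S_pow: "(b * h powr (-(1/2))) powr \<theta> = b powr \<theta> * h powr (-(1/2) * \<theta>)"
    using assms by (simp only: powr_mult powr_powr)
  have b_pow: "b powr (1 - \<theta>) * b powr \<theta> = b"
    using powr_add[of b "1 - \<theta>" \<theta>] assms by simp
  have h_pow: "h powr (-2 * (1 - \<theta>)) * h powr (-(1/2) * \<theta>) = h powr (3 / 2 * \<theta> - 2)"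
    using powr_add[of h "-2 * (1 - \<theta>)" "-(1/2) * \<theta>"] by (simp add: algebra_simps)
  have "(a * (b / sqrt h) / sqrt h ^ 3) powr (1 - \<theta>) * (b / sqrt h) powr \<theta>
      = a powr (1 - \<theta>) * (b powr (1 - \<theta>) * b powr \<theta>)
        * (h powr (-2 * (1 - \<theta>)) * h powr (-(1/2) * \<theta>))"
    unfolding M_eq unfolding S_eq M_pow S_pow by (simp only: ac_simps)
  also have "\<dots> = a powr (1 - \<theta>) * b * h powr (3 / 2 * \<theta> - 2)"
    by (simp only: b_pow h_pow)
  also have "\<dots> \<le> (1 + a) * b * h powr (3 / 2 * \<theta> - 2)"
    using \<open>a powr (1 - \<theta>) \<le> 1 + a\<close> assms by (intro mult_right_mono) auto
  finally show ?thesis .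
qed

lemma ennreal_exponent_bounds:
  fixes p :: ennreal
  assumes "2 \<le> p"
  shows "0 \<le> enn2real (2 / p)" "enn2real (2 / p) \<le> 1" "enn2real (3 / p) = 3 / 2 * enn2real (2 / p)"
proof -
  show "0 \<le> enn2real (2 / p)" by simp
  have "enn2real (2 / p) \<le> 1 \<and> enn2real (3 / p) = 3 / 2 * enn2real (2 / p)"
  proof (cases p)
    case top then show ?thesis by simp
  next
    case (real r)
    then have r: "2 \<le> r" using assms
      by (metis ennreal_le_iff ennreal_numeral zero_le_numeral)
    then have "2 / p = ennreal (2 / r)" "3 / p = ennreal (3 / r)"
      using real divide_ennreal[of 2 r] divide_ennreal[of 3 r] by simp_all
    then show ?thesis using r by simp
  qed
  then show "enn2real (2 / p) \<le> 1" "enn2real (3 / p) = 3 / 2 * enn2real (2 / p)" by simp_all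
qed

lemma discrete_green_Lp_bound:
  assumes M: "regular_mesh q h \<T>" and sub: "mesh_domain \<T> \<subseteq> \<Omega>" and p: "2 \<le> p"
  shows "Lp_norm p (mesh_domain \<T>) (grad (discrete_green \<Omega> \<T> z))
           \<le> ennreal ((1 + inverse_const q) * sobolev_const q * h powr (enn2real (3 / p) - 2))"
proof -
  let ?G = "discrete_green \<Omega> \<T> z"
  define S where "S = sobolev_const q / sqrt h"
  have T: "tet_mesh \<T>" and q: "0 < q" and h: "0 < h" using M by (auto simp: regular_mesh_def)
  note G = discrete_green_spec(1)[OF M sub, of z]
  have S: "0 < S" using sobolev_const_pos[OF q] h by (simp add: S_def)
  have E: "energy \<T> ?G ?G \<le> S\<^sup>2"
    using discrete_green_energy_bound[OF M sub] by (simp add: S_def)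
  have "Lp_norm p (mesh_domain \<T>) (grad ?G)
      \<le> ennreal ((inverse_const q * S / sqrt h ^ 3) powr (1 - enn2real (2 / p)) * S powr enn2real (2 / p))"
  proof (rule Lp_norm_interpolation[OF _ mesh_grad_measurable[OF T G] _ _ _ mesh_grad_integrable[OF T G G]])
    show "mesh_domain \<T> \<in> sets lebesgue" by (simp add: mesh_domain_def)
    show "AE x in lborel. grad ?G x = mesh_grad \<T> ?G x"
      by (rule eventually_mono[OF AE_not_in[OF null_mesh_skeleton[OF T]]]) (simp add: mesh_grad_def)
    show "norm (mesh_grad \<T> ?G x) \<le> inverse_const q * S / sqrt h ^ 3" for x
      using S by (intro inverse_estimate[OF M G E]) simp
    show "0 < inverse_const q * S / sqrt h ^ 3" using inverse_const_pos[OF q] S h by simp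
    show "(\<integral>x. mesh_grad \<T> ?G x \<bullet> mesh_grad \<T> ?G x \<partial>lborel) \<le> S\<^sup>2"
      using E by (simp add: energy_def)
  qed (use S p in auto)
  also have "(inverse_const q * S / sqrt h ^ 3) powr (1 - enn2real (2 / p)) * S powr enn2real (2 / p)
      \<le> (1 + inverse_const q) * sobolev_const q * h powr (3 / 2 * enn2real (2 / p) - 2)"
    unfolding S_def using ennreal_exponent_bounds[OF p] inverse_const_pos[OF q] sobolev_const_pos[OF q] h
    by (intro interpolated_power)
  finally show ?thesis
    by (simp add: ennreal_exponent_bounds(3)[OF p] ennreal_leI)
qed

lemma quasi_uniform_regular_mesh:
  assumes T: "\<And>h. 0 < h \<Longrightarrow> h < 1 \<Longrightarrow> tet_mesh (T h)"
    and "mesh_size T" "quasi_uniform T" "shape_regular T"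
  shows "\<exists>q. \<forall>h. 0 < h \<and> h < 1 \<longrightarrow> regular_mesh q h (T h)"
proof -
  obtain \<kappa> where \<kappa>: "0 < \<kappa>" "\<forall>h\<in>{0<..<1}. \<forall>\<tau>\<in>T h. \<kappa> * h \<le> diameter \<tau>"
    using assms(3) by (auto simp: quasi_uniform_def)
  obtain \<sigma> where \<sigma>: "0 < \<sigma>" "\<forall>h\<in>{0<..<1}. \<forall>\<tau>\<in>T h. \<exists>c. cball c (\<sigma> * diameter \<tau>) \<subseteq> \<tau>"
    using assms(4) by (auto simp: shape_regular_def)
  have "regular_mesh (\<sigma> * \<kappa>) h (T h)" if h: "0 < h" "h < 1" for h
    unfolding regular_mesh_def
  proof (intro conjI ballI)
    fix \<tau> assume \<tau>: "\<tau> \<in> T h"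
    have h01: "h \<in> {0<..<1}" using h by simp
    show "diameter \<tau> \<le> h" using assms(2) h \<tau> by (simp add: mesh_size_def)
    obtain c where c: "cball c (\<sigma> * diameter \<tau>) \<subseteq> \<tau>" using \<sigma>(2) h01 \<tau> by blast
    have "\<kappa> * h \<le> diameter \<tau>" using \<kappa>(2) h \<tau> by simp
    then have "\<sigma> * \<kappa> * h \<le> \<sigma> * diameter \<tau>" using \<sigma>(1) by (simp add: mult.assoc)
    then show "\<exists>c. cball c (\<sigma> * \<kappa> * h) \<subseteq> \<tau>" using c subset_cball order_trans by meson
  qed (use T h \<kappa> \<sigma> in auto)
  then show ?thesis by blast
qed

theorem corollary4p5:
  fixes \<Omega> :: "(real^3) set" and T :: "real \<Rightarrow> (real^3) set set" and k :: nat
  assumes "open \<Omega>" and "\<Omega> \<noteq> {}" and "convex \<Omega>" and "bounded \<Omega>"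
    and "k \<ge> 1" and "Ck_boundary k \<Omega>"
    and "\<And>h. 0 < h \<Longrightarrow> h < 1 \<Longrightarrow> tet_mesh (T h)"
    and "\<And>h. 0 < h \<Longrightarrow> h < 1 \<Longrightarrow> connected (mesh_domain (T h))"
    and "\<And>h. 0 < h \<Longrightarrow> h < 1 \<Longrightarrow> mesh_domain (T h) \<subseteq> \<Omega>"
    and "mesh_size T" and "quasi_uniform T" and "shape_regular T"
  shows "\<exists>C::real. \<forall>h z. \<forall>p::ennreal.
    0 < h \<and> h < 1 \<and> z \<in> mesh_domain (T h) \<and> 2 \<le> p \<longrightarrow>
      Lp_norm p (mesh_domain (T h)) (grad (discrete_green \<Omega> (T h) z))
        \<le> ennreal (C * h powr (enn2real (3 / p) - 2))"
proof -
  obtain q where q: "\<forall>h. 0 < h \<and> h < 1 \<longrightarrow> regular_mesh q h (T h)"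
    using quasi_uniform_regular_mesh[OF assms(7,10,11,12)] by blast
  show ?thesis
  proof (intro exI[of _ "(1 + inverse_const q) * sobolev_const q"] allI impI)
    fix h :: real and z :: R3 and p :: ennreal
    assume "0 < h \<and> h < 1 \<and> z \<in> mesh_domain (T h) \<and> 2 \<le> p"
    then show "Lp_norm p (mesh_domain (T h)) (grad (discrete_green \<Omega> (T h) z))
        \<le> ennreal ((1 + inverse_const q) * sobolev_const q * h powr (enn2real (3 / p) - 2))"
      using q assms(9) by (intro discrete_green_Lp_bound) simp_all
  qed
qed

end
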